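(* Let $\mathcal{G}_1=(V_1,E_1)$ and $\mathcal{G}_2=(V_2,E_2)$ be finite trees such that $\mathcal{G}_1$ is a subgraph of $\mathcal{G}_2$. Then $$\lambda_2(\mathcal{G}_2)\le \lambda_2(\mathcal{G}_1).$$ Furthermore, equality holds if and only if either $\mathcal{G}_1=\mathcal{G}_2$, or there exist a vertex $x\in V_1$ (also regarded as a vertex of $\mathcal{G}_2$), an enumeration $x_1,\dots,x_{m_1}$ of the neighbors of $x$ in $\mathcal{G}_1$ and an enumeration $y_1,\dots,y_{m_2}$ of the neighbors of $x$ in $\mathcal{G}_2$ (where $m_1,m_2\ge 2$ are the degrees of $x$ in $\mathcal{G}_1,\mathcal{G}_2$ respectively) such that $$\sigma(\mathcal{G}_{1,1},x)=\sigma(\mathcal{G}_{1,2},x)=\min_{1\le j\le m_1}\sigma(\mathcal{G}_{1,j},x)=\sigma(\mathcal{G}_{2,1},x)=\sigma(\mathcal{G}_{2,2},x)=\min_{1\le s\le m_2}\sigma(\mathcal{G}_{2,s},x),$$ where $\mathcal{G}_{1,j}:=\mathcal{H}_{1,j}(x_j,x)$ with $\mathcal{H}_{1,j}$ the branch from $(x_j,x)$ in $\mathcal{G}_1$, and $\mathcal{G}_{2,s}:=\mathcal{H}_{2,s}(y_s,x)$ with $\mathcal{H}_{2,s}$ the branch from $(y_s,x)$ in $\mathcal{G}_2$.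
   Context: All trees are finite and have at least two vertices. For a tree $\mathcal{G}=(V,E)$, $E$ is the set of directed edges (each edge appears with both orientations), $d$ is the combinatorial distance, the boundary $\delta\mathcal{G}$ is the set of vertices of degree one, and $\Omega:=V\setminus\delta\mathcal{G}$ is the interior. $\mathcal{G}_1$ is a subgraph of $\mathcal{G}_2$ if there is an injective graph homomorphism from $\mathcal{G}_1$ to $\mathcal{G}_2$; one fixes it and regards $V_1\subset V_2$, $E_1\subset E_2$. Graphs are not distinguished up to isomorphism, so $\mathcal{G}_1=\mathcal{G}_2$ means isomorphic. For $f\in\mathbb{R}^V$, $\Delta f(x)=\sum_{y\sim x}(f(x)-f(y))$, and for $x\in\delta\mathcal{G}$ with its neighbor $y$, $\frac{\partial f}{\partial n}(x)=f(x)-f(y)$. A real $\lambda$ is a Steklov eigenvalue of $\mathcal{G}$ if there is a nonzero $f\in\mathbb{R}^V$ (a Steklov eigenfunction) with $\Delta f=0$ on $\Omega$ and $\frac{\partial f}{\partial n}=\lambda f$ on $\delta\mathcal{G}$. Counted with multiplicity these are $0=\lambda_1<\lambda_2\le\dots\le\lambda_{|\delta\mathcal{G}|}$, and $\lambda_2(\mathcal{G})$ denotes the first nonzero one. For $(x,y)\in E$, the branch from $(x,y)$ is the connected component $\mathcal{H}$ containing $x$ after removing the edge between $x$ and $y$ from $\mathcal{G}$; $\mathcal{H}(x,y)$ is the subtree generated by the vertices of $\mathcal{H}$ together with $y$ (so $y$ is a boundary vertex of $\mathcal{H}(x,y)$). For a finite tree $\mathcal{G}$, $x\in V$ and $\lambda\ge0$,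 a $\lambda$-flow to $x$ is a nonzero $f\in\mathbb{R}^V$ with $\Delta f(w)=0$ for $w\in\Omega\setminus\{x\}$ and $\frac{\partial f}{\partial n}(w)=\lambda f(w)$ for $w\in\delta\mathcal{G}\setminus\{x\}$. For $x\in\delta\mathcal{G}$, $\Sigma(\mathcal{G},x)$ is the set of $\lambda\ge0$ for which there is a $\lambda$-flow $f$ to $x$ with $f(x)=0$ and $f(y)-f(z)>0$ for every $(y,z)\in E$ with $d(x,y)>d(x,z)$; and $\sigma(\mathcal{G},x):=\inf\Sigma(\mathcal{G},x)$. *)

theory Defs
  imports Complex_Main "Graph_Theory.Graph_Theory"
begin

text \<open>
  A simple graph is a symmetric digraph of locale \<^locale>\<open>graph\<close>: each edge occurs as two arcs, one
  for each orientation.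
\<close>

definition neighbors :: "('a, 'b) pre_digraph \<Rightarrow> 'a \<Rightarrow> 'a set" where
  "neighbors G x = {y. x \<rightarrow>\<^bsub>G\<^esub> y}"

text \<open>
  In a symmetric digraph, traversing an edge back and forth already is a
  \<^const>\<open>pre_digraph.cycle\<close> (of length 2), so \<^const>\<open>tree\<close> fails for every graph with an
  edge. The cycles of the underlying undirected graph are those of length at least 3.
\<close>

definition finite_tree :: "('a, 'b) pre_digraph \<Rightarrow> bool" where
  "finite_tree G \<longleftrightarrow>
     Digraph.graph G \<and> Digraph_Component.connected G \<and> card (verts G) \<ge> 2 \<and>
     \<not> (\<exists>p. pre_digraph.cycle G p \<and> length p \<ge> 3)"

text \<open>There are no parallel arcs, so a homomorphism is determined by its action on vertices.\<close>

definition inj_graph_hom :: "('a \<Rightarrow> 'c) \<Rightarrow> ('a, 'b) pre_digraph \<Rightarrow> ('c, 'd) pre_digraph \<Rightarrow> bool" where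
  "inj_graph_hom \<phi> G H \<longleftrightarrow>
     \<phi> ` verts G \<subseteq> verts H \<and> inj_on \<phi> (verts G) \<and>
     (\<forall>x y. x \<rightarrow>\<^bsub>G\<^esub> y \<longrightarrow> \<phi> x \<rightarrow>\<^bsub>H\<^esub> \<phi> y)"

definition graph_dist :: "('a, 'b) pre_digraph \<Rightarrow> 'a \<Rightarrow> 'a \<Rightarrow> ereal" where
  "graph_dist G x y = wf_digraph.\<mu> G (\<lambda>_. 1) x y"

definition boundary_verts :: "('a, 'b) pre_digraph \<Rightarrow> 'a set" where
  "boundary_verts G = {x \<in> verts G. out_degree G x = 1}"

definition interior_verts :: "('a, 'b) pre_digraph \<Rightarrow> 'a set" where
  "interior_verts G = verts G - boundary_verts G"

text \<open>
  Elements of \<open>\<real>\<^sup>V\<close> are functions on the whole vertex type; only their values on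
  \<^term>\<open>verts G\<close> matter below.
\<close>

definition laplacian :: "('a, 'b) pre_digraph \<Rightarrow> ('a \<Rightarrow> real) \<Rightarrow> 'a \<Rightarrow> real" where
  "laplacian G f x = (\<Sum>y\<in>neighbors G x. f x - f y)"

definition normal_deriv :: "('a, 'b) pre_digraph \<Rightarrow> ('a \<Rightarrow> real) \<Rightarrow> 'a \<Rightarrow> real" where
  "normal_deriv G f x = f x - f (THE y. y \<in> neighbors G x)"

definition steklov_eigenvalue :: "('a, 'b) pre_digraph \<Rightarrow> real \<Rightarrow> bool" where
  "steklov_eigenvalue G lam \<longleftrightarrow>
     (\<exists>f. (\<exists>x\<in>verts G. f x \<noteq> 0) \<and>
          (\<forall>x\<in>interior_verts G. laplacian G f x = 0) \<and>
          (\<forall>x\<in>boundary_verts G. normal_deriv G f x = lam * f x))"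

text \<open>
  On a finite tree there are, with multiplicity, as many eigenvalues as boundary vertices (at least
  two), and 0 is a simple one, so the minimum is over a finite nonempty set of positive reals.
\<close>

definition lambda2 :: "('a, 'b) pre_digraph \<Rightarrow> real" where
  "lambda2 G = Min {lam. steklov_eigenvalue G lam \<and> lam \<noteq> 0}"

definition delete_edge :: "('a, 'b) pre_digraph \<Rightarrow> 'a \<Rightarrow> 'a \<Rightarrow> ('a, 'b) pre_digraph" where
  "delete_edge G x y = G\<lparr>arcs := {e \<in> arcs G. arc_to_ends G e \<notin> {(x, y), (y, x)}}\<rparr>"

text \<open>In a symmetric digraph, strongly connected components are the connected components.\<close>

definition branch :: "('a, 'b) pre_digraph \<Rightarrow> 'a \<Rightarrow> 'a \<Rightarrow> ('a, 'b) pre_digraph" where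
  "branch G x y = delete_edge G x y \<restriction> pre_digraph.scc_of (delete_edge G x y) x"

text \<open>The subtree \<open>\<H>(x, y)\<close>, in which \<open>y\<close> is a boundary vertex.\<close>

definition branch_with_root :: "('a, 'b) pre_digraph \<Rightarrow> 'a \<Rightarrow> 'a \<Rightarrow> ('a, 'b) pre_digraph" where
  "branch_with_root G x y = G \<restriction> insert y (verts (branch G x y))"

definition is_flow :: "('a, 'b) pre_digraph \<Rightarrow> 'a \<Rightarrow> real \<Rightarrow> ('a \<Rightarrow> real) \<Rightarrow> bool" where
  "is_flow G x lam f \<longleftrightarrow>
     (\<exists>w\<in>verts G. f w \<noteq> 0) \<and>
     (\<forall>w\<in>interior_verts G - {x}. laplacian G f w = 0) \<and>
     (\<forall>w\<in>boundary_verts G - {x}. normal_deriv G f w = lam * f w)"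

definition Sigma_set :: "('a, 'b) pre_digraph \<Rightarrow> 'a \<Rightarrow> real set" where
  "Sigma_set G x =
     {lam. lam \<ge> 0 \<and>
         (\<exists>f. is_flow G x lam f \<and> f x = 0 \<and>
              (\<forall>y z. y \<rightarrow>\<^bsub>G\<^esub> z \<and> graph_dist G x y > graph_dist G x z \<longrightarrow> f y - f z > 0))}"

definition sigma :: "('a, 'b) pre_digraph \<Rightarrow> 'a \<Rightarrow> real" where
  "sigma G x = Inf (Sigma_set G x)"

end

theory Submission
  imports Defs "HOL-Analysis.Function_Topology"
begin

text \<open>
  Write \<open>\<E>\<close> for the Dirichlet energy and \<open>\<delta>\<close> for the boundary. Then \<open>\<lambda>\<^sub>2\<close> is the minimum of
  \<open>\<E>(f) / \<Sum>\<^sub>\<delta> f\<^sup>2\<close> over the \<open>f\<close> with \<open>\<Sum>\<^sub>\<delta> f = 0\<close>, and \<open>\<sigma>(\<H>, x)\<close> is the minimum of the same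
  quotient over the \<open>f\<close> with \<open>f(x) = 0\<close>: flows increasing away from \<open>x\<close> are exactly the positive
  minimizers.

  Extend an eigenfunction \<open>f\<close> of \<open>\<G>\<^sub>1\<close> to \<open>\<G>\<^sub>2\<close> by constants on the added pieces. The energy does
  not change, and the variance on the boundary does not decrease, since every boundary vertex of
  \<open>\<G>\<^sub>1\<close> has a boundary vertex of \<open>\<G>\<^sub>2\<close> above it; this gives the inequality. In case of equality the
  extension is itself an eigenfunction. It vanishes on an added leaf, since it is constant near that
  leaf, so \<open>f\<close> has a zero \<open>x\<close> with a nonzero neighbour. By harmonicity at \<open>x\<close> two branches carry
  a nonzero \<open>f\<close>, hence have \<open>\<sigma> \<le> \<lambda>\<^sub>2\<close>. On the other hand, a combination of the minimizers of two
  branches has mean zero, so no two branches have \<open>\<sigma> \<le> \<lambda>\<^sub>2\<close> unless both equal \<open>\<lambda>\<^sub>2\<close>. This holds in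
  both trees. Conversely, if two branches at \<open>x\<close> attain the minimal \<open>\<sigma>\<close>, the same combination
  gives \<open>\<lambda>\<^sub>2 \<le> \<sigma>\<close>, and \<open>\<E>(f) \<ge> \<sigma> \<Sum>\<^sub>\<delta> (f - f(x))\<^sup>2\<close>, summed over the branches, gives \<open>\<lambda>\<^sub>2 \<ge> \<sigma>\<close>.
\<close>

section \<open>Components of a tree after removing an edge\<close>

locale ftree =
  fixes G :: "('a, 'b) pre_digraph" (structure)
  assumes finite_tree: "finite_tree G"
begin

lemma graph: "Digraph.graph G" and conn: "Digraph_Component.connected G"
  and card_verts: "card (verts G) \<ge> 2"
  and acyclic: "pre_digraph.cycle G p \<Longrightarrow> length p < 3"
  using finite_tree unfolding finite_tree_def by (auto simp: not_le[symmetric])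

end
sublocale ftree \<subseteq> graph G by (rule graph)

context ftree begin

abbreviation "E \<equiv> arcs_ends G"
abbreviation "V \<equiv> verts G"
abbreviation "N \<equiv> neighbors G"

lemma E_verts: "(u, v) \<in> E \<Longrightarrow> u \<in> V" "(u, v) \<in> E \<Longrightarrow> v \<in> V"
  by (auto dest: adj_in_verts)

lemma E_sym: "(u, v) \<in> E \<Longrightarrow> (v, u) \<in> E"
  by (rule graph_symmetric)

lemma E_irrefl: "(u, u) \<notin> E"
  using adj_not_same by blast

lemma finite_E: "finite E"
  by (simp add: arcs_ends_def)

lemma N_iff: "v \<in> N u \<longleftrightarrow> (u, v) \<in> E"
  by (simp add: neighbors_def)

lemma N_subset: "N u \<subseteq> V"
  by (auto simp: N_iff dest: E_verts)

lemma finite_N: "finite (N u)"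
  by (rule finite_subset[OF N_subset finite_verts])

lemma out_degree_eq: "out_degree G x = card (N x)"
proof -
  have "N x = head G ` out_arcs G x"
    by (auto simp: neighbors_def arcs_ends_conv out_arcs_def)
  moreover have "inj_on (head G) (out_arcs G x)"
    by (auto simp: inj_on_def arc_to_ends_def intro: no_multi_arcs)
  ultimately show ?thesis
    by (simp add: out_degree_def card_image)
qed

lemma E_rtrancl: assumes "u \<in> V" "v \<in> V" shows "(u, v) \<in> E\<^sup>*"
proof -
  have "u \<rightarrow>\<^sup>*\<^bsub>mk_symmetric G\<^esub> v"
    using conn assms by (simp add: Digraph_Component.connected_def strongly_connected_def)
  then have "u \<rightarrow>\<^sup>* v"
    by (simp add: reachable_mk_symmetric_eq[OF sym_arcs])
  then show ?thesis by (rule reachable_rtranclI)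
qed

definition Cut :: "'a \<Rightarrow> 'a \<Rightarrow> ('a \<times> 'a) set" where
  "Cut y z = E - {(y, z), (z, y)}"

text \<open>The vertex set of the branch from \<open>(y, z)\<close>, written as reachability along
  pairs so that induction over \<open>rtrancl\<close> applies directly; \<open>verts_branch\<close>
  gives the link to \<open>branch\<close>.\<close>

definition Cmp :: "'a \<Rightarrow> 'a \<Rightarrow> 'a set" where
  "Cmp y z = {w. (y, w) \<in> (Cut y z)\<^sup>*}"

lemma arcs_ends_delete_edge: "arcs_ends (delete_edge G y z) = Cut y z"
  by (auto simp: delete_edge_def Cut_def arcs_ends_def arc_to_ends_def)

lemma verts_delete_edge: "verts (delete_edge G y z) = V"
  by (simp add: delete_edge_def)

lemma wf_delete_edge: "wf_digraph (delete_edge G y z)"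
  by unfold_locales (auto simp: delete_edge_def)

lemma sym_Cut: "sym (Cut y z)"
  by (auto simp: sym_def Cut_def intro: E_sym)

lemma Cut_rtrancl_sym: "(u, v) \<in> (Cut y z)\<^sup>* \<Longrightarrow> (v, u) \<in> (Cut y z)\<^sup>*"
  using sym_Cut[of y z] sym_rtrancl symD by metis

lemma Cut_commute: "Cut y z = Cut z y"
  by (auto simp: Cut_def)

lemma self_in_Cmp: "y \<in> Cmp y z"
  by (simp add: Cmp_def)

lemma verts_branch:
  assumes "y \<in> V" shows "verts (branch G y z) = Cmp y z"
proof -
  interpret D: wf_digraph "delete_edge G y z" by (rule wf_delete_edge)
  have "symmetric (delete_edge G y z)"
    using sym_Cut by (simp add: symmetric_def arcs_ends_delete_edge)
  then have "D.scc_of y = {v. y \<rightarrow>\<^sup>*\<^bsub>delete_edge G y z\<^esub> v}"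
    by (auto simp: D.scc_of_def intro: symmetric_reachable)
  also have "\<dots> = Cmp y z"
    using assms by (simp add: D.reachable_conv' verts_delete_edge Cmp_def arcs_ends_delete_edge)
  finally show ?thesis by (simp add: branch_def)
qed

text \<open>Acyclicity: a path from \<open>y\<close> to \<open>z\<close> that avoids their edge,
  closed up by the arc from \<open>z\<close> to \<open>y\<close>, is a cycle. Its length is at least
  3, since the only path with a single arc would be the deleted one.\<close>

lemma root_notin_Cmp:
  assumes yz: "(y, z) \<in> E" shows "z \<notin> Cmp y z"
proof
  assume "z \<in> Cmp y z"
  interpret D: wf_digraph "delete_edge G y z" by (rule wf_delete_edge)
  have sub: "subgraph (delete_edge G y z) G"
    using wf_delete_edge[of y z] wf_digraph
    by (auto simp: subgraph_def delete_edge_def compatible_def)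
  have "y \<rightarrow>\<^sup>*\<^bsub>delete_edge G y z\<^esub> z"
    using \<open>z \<in> Cmp y z\<close> E_verts(1)[OF yz] D.reachable_conv'[of y z]
    by (simp add: verts_delete_edge Cmp_def arcs_ends_delete_edge)
  then obtain p where p: "D.apath y p z"
    using D.reachable_apath by blast
  then have pG: "apath y p z"
    using subgraph_apath_imp_apath[OF _ sub] by blast
  have ne: "y \<noteq> z" using yz E_irrefl by blast
  have "p \<noteq> []" using pG ne by (auto simp: apath_simps)
  moreover have "length p \<noteq> 1"
  proof
    assume "length p = 1"
    then obtain e where e: "p = [e]" by (auto simp: length_Suc_conv)
    with p have "e \<in> arcs (delete_edge G y z)" "tail (delete_edge G y z) e = y" "head (delete_edge G y z) e = z"
      by (auto simp: D.apath_simps)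
    then show False by (auto simp: delete_edge_def arc_to_ends_def)
  qed
  ultimately have len: "length p \<ge> 2" by (cases p) (auto simp: Suc_le_eq)
  obtain e where e: "e \<in> arcs G" "tail G e = z" "head G e = y"
    using E_sym[OF yz] by auto
  have aw: "awalk y p z" and dist: "distinct (awalk_verts y p)"
    using pG by (auto simp: apath_def)
  have "cycle (e # p)"
    unfolding cycle_def using e aw dist
    by (intro exI[of _ z]) (auto simp: awalk_simps)
  from acyclic[OF this] len show False by simp
qed

text \<open>A step outside \<open>Cut y z\<close> uses the removed edge, and it can only start at
  \<open>y\<close>, because \<open>z\<close> lies outside the component.\<close>

lemma Cmp_closed:
  assumes "w \<in> Cmp y z" "(w, w') \<in> E" "(y, z) \<in> E"
  shows "w' \<in> Cmp y z \<or> w' = z \<and> w = y"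
proof (cases "(w, w') \<in> Cut y z")
  case True
  then show ?thesis using assms(1) by (auto simp: Cmp_def intro: rtrancl_into_rtrancl)
next
  case False
  then have "(w, w') \<in> {(y, z), (z, y)}" using assms(2) by (auto simp: Cut_def)
  then show ?thesis using assms root_notin_Cmp by auto
qed

lemma Cmp_subset: "y \<in> V \<Longrightarrow> Cmp y z \<subseteq> V"
proof
  fix w assume y: "y \<in> V" and "w \<in> Cmp y z"
  then have "(y, w) \<in> (Cut y z)\<^sup>*" by (simp add: Cmp_def)
  then show "w \<in> V" using y by (induction) (auto simp: Cut_def dest: E_verts)
qed

text \<open>A common vertex of the two sides would connect \<open>y\<close> to \<open>z\<close>
  without their edge. Every vertex lies on some side, because a walk from \<open>z\<close> changes
  sides only across that edge.\<close>

lemma Cmp_compl: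
  assumes yz: "(y, z) \<in> E" and w: "w \<in> V"
  shows "w \<in> Cmp z y \<longleftrightarrow> w \<notin> Cmp y z"
proof
  assume "w \<in> Cmp z y"
  then have "(z, w) \<in> (Cut y z)\<^sup>*" by (simp add: Cmp_def Cut_commute)
  show "w \<notin> Cmp y z"
  proof
    assume "w \<in> Cmp y z"
    then have "(y, z) \<in> (Cut y z)\<^sup>*"
      using Cut_rtrancl_sym[OF \<open>(z, w) \<in> (Cut y z)\<^sup>*\<close>] by (auto simp: Cmp_def)
    then show False using root_notin_Cmp[OF yz] by (simp add: Cmp_def)
  qed
next
  assume notin: "w \<notin> Cmp y z"
  have "(z, w) \<in> E\<^sup>*" using E_verts yz w E_rtrancl by blast
  then have "w \<in> Cmp y z \<union> Cmp z y"
  proof induction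
    case base show ?case by (simp add: self_in_Cmp)
  next
    case (step u v)
    then show ?case
      using Cmp_closed[OF _ step(2) yz] Cmp_closed[OF _ step(2) E_sym[OF yz]] self_in_Cmp by blast
  qed
  then show "w \<in> Cmp z y" using notin by blast
qed

text \<open>Seen from the root side \<open>z\<close>, \<open>u\<close> is a child of
  \<open>y\<close>: a path inside the component of \<open>u\<close> never meets \<open>y\<close>, so
  it cannot leave the component of \<open>y\<close>.\<close>

lemma Cmp_child_psubset:
  assumes yz: "(y, z) \<in> E" and uy: "(u, y) \<in> E" and "u \<noteq> z"
  shows "Cmp u y \<subset> Cmp y z"
proof -
  have "w \<in> Cmp y z" if "w \<in> Cmp u y" for w
  proof -
    have "(u, w) \<in> (Cut u y)\<^sup>*" using that by (simp add: Cmp_def)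
    then show ?thesis
    proof induction
      case base
      show ?case using Cmp_closed[OF self_in_Cmp E_sym[OF uy] yz] \<open>u \<noteq> z\<close> by blast
    next
      case (step a b)
      have "a \<in> Cmp u y" using step(1) by (simp add: Cmp_def)
      then have "a \<noteq> y" using root_notin_Cmp[OF uy] by blast
      moreover have "(a, b) \<in> E" using step(2) by (simp add: Cut_def)
      ultimately show ?case using Cmp_closed[OF step(3) _ yz] by blast
    qed
  qed
  moreover have "y \<notin> Cmp u y" by (rule root_notin_Cmp[OF uy])
  ultimately show ?thesis using self_in_Cmp[of y z] by blast
qed

lemma finite_Cmp: "y \<in> V \<Longrightarrow> finite (Cmp y z)"
  by (rule finite_subset[OF Cmp_subset finite_verts])

text \<open>Induction from the leaves towards the arc \<open>(y, z)\<close>: the neighbours of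
  \<open>y\<close> other than \<open>z\<close> are its children. At a leaf there are none, so the
  base case is included in the step.\<close>

lemma Cmp_induct [consumes 1, case_names step]:
  assumes "(y, z) \<in> E"
    and "\<And>y z. (y, z) \<in> E \<Longrightarrow> (\<And>u. u \<in> N y - {z} \<Longrightarrow> Cmp u y \<subset> Cmp y z \<Longrightarrow> P u y) \<Longrightarrow> P y z"
  shows "P y z"
  using assms(1)
proof (induction "card (Cmp y z)" arbitrary: y z rule: less_induct)
  case less
  show ?case
  proof (rule assms(2)[OF less(2)])
    fix u assume u: "u \<in> N y - {z}" and sub: "Cmp u y \<subset> Cmp y z"
    have uy: "(u, y) \<in> E" using u by (auto simp: N_iff intro: E_sym)
    show "P u y"
      using less(1)[OF _ uy] psubset_card_mono[OF finite_Cmp sub] E_verts less(2) by blast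
  qed
qed

section \<open>Boundary vertices and leaves of components\<close>

abbreviation "\<delta> \<equiv> boundary_verts G"

lemma boundary_iff: "w \<in> \<delta> \<longleftrightarrow> w \<in> V \<and> card (N w) = 1"
  by (simp add: boundary_verts_def out_degree_eq)

lemma boundary_subset: "\<delta> \<subseteq> V" by (auto simp: boundary_iff)

lemma finite_boundary: "finite \<delta>"
  by (rule finite_subset[OF boundary_subset finite_verts])

lemma boundary_neighbors: assumes "w \<in> \<delta>" "(w, u) \<in> E" shows "N w = {u}"
proof -
  obtain v where "N w = {v}" using assms(1) card_1_singletonE by (auto simp: boundary_iff)
  moreover have "u \<in> N w" using assms(2) by (simp add: N_iff)
  ultimately show ?thesis by simp
qed

lemma notin_boundary_neighbors:
  assumes "(w, u) \<in> E" "w \<notin> \<delta>" shows "N w - {u} \<noteq> {}"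
proof
  assume "N w - {u} = {}"
  then have "N w = {u}" using assms by (auto simp: N_iff)
  then show False using assms E_verts by (auto simp: boundary_iff)
qed

lemma Cmp_leaf: assumes "(y, z) \<in> E" shows "\<exists>w. w \<in> \<delta> \<inter> Cmp y z"
  using assms
proof (induction rule: Cmp_induct)
  case (step y z)
  show ?case
  proof (cases "y \<in> \<delta>")
    case True then have "y \<in> \<delta> \<inter> Cmp y z" by (simp add: self_in_Cmp)
    then show ?thesis ..
  next
    case False
    obtain u where u: "u \<in> N y - {z}" using notin_boundary_neighbors[OF step(1) False] by blast
    then have "Cmp u y \<subset> Cmp y z" using Cmp_child_psubset[OF step(1)] by (auto simp: N_iff intro: E_sym)
    then show ?thesis using step(2)[OF u] by blast
  qed
qed

lemma neighbor_exists: assumes "w \<in> V" shows "\<exists>u. (w, u) \<in> E"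
proof -
  have "\<not> V \<subseteq> {w}" using card_verts card_mono[of "{w}" V] by auto
  then obtain v where "v \<in> V" "v \<noteq> w" by blast
  then show ?thesis using E_rtrancl[OF assms] by (metis converse_rtranclE)
qed

text \<open>\<open>z\<close> is the first vertex on the way from \<open>w\<close> to
  \<open>x\<close>. Along a walk from \<open>w\<close> the branch at \<open>w\<close> containing the
  current vertex changes only when the walk returns to \<open>w\<close>.\<close>

lemma Cmp_towards:
  assumes "x \<in> V" "w \<in> V" "w \<noteq> x"
  shows "\<exists>z. (w, z) \<in> E \<and> x \<in> Cmp z w"
proof -
  have "(w, x) \<in> E\<^sup>*" using E_rtrancl assms by blast
  then have "x = w \<or> (\<exists>z. (w, z) \<in> E \<and> x \<in> Cmp z w)"
  proof induction
    case base show ?case by simp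
  next
    case (step a b)
    then show ?case using Cmp_closed[OF _ step(2) E_sym] self_in_Cmp by metis
  qed
  then show ?thesis using assms by blast
qed

text \<open>Seen across the edge from \<open>x\<close> to \<open>y'\<close>, the whole branch of
  \<open>y\<close> lies on the side of \<open>x\<close>.\<close>

lemma Cmp_disjoint:
  assumes y: "(y, x) \<in> E" and y': "(y', x) \<in> E" and "y \<noteq> y'"
  shows "Cmp y x \<inter> Cmp y' x = {}"
proof -
  have "Cmp y x \<subset> Cmp x y'" using Cmp_child_psubset[OF E_sym[OF y'] y \<open>y \<noteq> y'\<close>] .
  moreover have "w \<notin> Cmp y' x" if "w \<in> Cmp x y'" for w
    using Cmp_compl[OF y'] Cmp_subset that E_verts[OF y'] by blast
  ultimately show ?thesis by blast
qed

lemma two_le_card_boundary: "card \<delta> \<ge> 2"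
proof -
  have "V \<noteq> {}" using card_verts by auto
  then obtain y z where yz: "(y, z) \<in> E" using neighbor_exists by blast
  obtain a b where a: "a \<in> \<delta> \<inter> Cmp y z" and b: "b \<in> \<delta> \<inter> Cmp z y"
    using Cmp_leaf[OF yz] Cmp_leaf[OF E_sym[OF yz]] by blast
  then have "a \<noteq> b" using Cmp_compl[OF yz] boundary_subset by blast
  then have "card {a, b} = 2" by simp
  moreover have "{a, b} \<subseteq> \<delta>" using a b by blast
  ultimately show ?thesis using card_mono[OF finite_boundary] by metis
qed

section \<open>A branch together with its root is again a tree\<close>

lemma verts_rooted_branch: "y \<in> V \<Longrightarrow> verts (branch_with_root G y x) = insert x (Cmp y x)"
  by (simp add: branch_with_root_def verts_branch)

lemma arcs_ends_rooted_branch: 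
  assumes "y \<in> V" shows "arcs_ends (branch_with_root G y x) = {(u, v) \<in> E. u \<in> insert x (Cmp y x) \<and> v \<in> insert x (Cmp y x)}"
  using assms by (auto simp: branch_with_root_def verts_branch arcs_ends_def arc_to_ends_def induce_subgraph_def)

lemma finite_tree_rooted_branch:
  assumes yx: "(y, x) \<in> E" shows "finite_tree (branch_with_root G y x)"
proof -
  let ?B = "branch_with_root G y x" and ?S = "insert x (Cmp y x)"
  have y: "y \<in> V" "x \<in> V" using yx E_verts by blast+
  have S: "?S \<subseteq> V" using y Cmp_subset by blast
  have B: "?B = G \<restriction> ?S" by (simp add: branch_with_root_def verts_branch y)
  have sub: "subgraph ?B G"
    unfolding B using S by (intro subgraphI wellformed_induce_subgraph) (auto simp: compatible_def wf_digraph)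
  have ind: "induced_subgraph ?B G"
    unfolding B using S by (rule induced_induce)
  interpret B: digraph ?B by (rule digraphI_induced[OF ind])
  have g: "Digraph.graph ?B"
    using induced_graph_imp_symmetric[OF sym_arcs ind] by (rule B.graphI)
  interpret B: graph ?B by (rule g)
  have xy: "(x, y) \<in> arcs_ends ?B" "(y, x) \<in> arcs_ends ?B"
    using yx E_sym by (auto simp: arcs_ends_rooted_branch y self_in_Cmp)
  \<comment> \<open>A path that witnesses membership in the component stays inside it, so it
    survives in the induced subgraph; \<open>x\<close> is attached through \<open>y\<close>.\<close>
  have reach: "(y, w) \<in> (arcs_ends ?B)\<^sup>*" if "w \<in> ?S" for w
  proof (cases "w = x")
    case True then show ?thesis using xy by blast
  next
    case False
    then have "(y, w) \<in> (Cut y x)\<^sup>*" using that by (simp add: Cmp_def)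
    then show ?thesis
    proof induction
      case base show ?case by simp
    next
      case (step a b)
      have "a \<in> Cmp y x" "b \<in> Cmp y x" using step by (auto simp: Cmp_def intro: rtrancl_into_rtrancl)
      then have "(a, b) \<in> arcs_ends ?B" using step(2) by (auto simp: arcs_ends_rooted_branch y Cut_def)
      with step(3) show ?case by auto
    qed
  qed
  have "reachable ?B u v" if "u \<in> verts ?B" "v \<in> verts ?B" for u v
  proof -
    have "reachable ?B y u" "reachable ?B y v"
      using reach that by (auto simp: B.reachable_conv' verts_rooted_branch y self_in_Cmp)
    then show ?thesis using B.symmetric_reachable' B.reachable_trans by blast
  qed
  then have c: "Digraph_Component.connected ?B"
    by (simp add: Digraph_Component.connected_def strongly_connected_def verts_rooted_branch y
      B.reachable_mk_symmetric_eq[OF B.sym_arcs])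
  have "x \<noteq> y" using yx E_irrefl by blast
  then have "card {x, y} = 2" by simp
  moreover have "{x, y} \<subseteq> verts ?B" by (auto simp: verts_rooted_branch y self_in_Cmp)
  ultimately have "card (verts ?B) \<ge> 2" using card_mono[OF B.finite_verts] by metis
  moreover have "length p < 3" if "pre_digraph.cycle ?B p" for p
    using that subgraph_cycle[OF sub] acyclic by blast
  ultimately show ?thesis using g c by (auto simp: finite_tree_def not_le)
qed
end

text \<open>First-order condition at a minimum: for small \<open>t\<close> of sign opposite to
  \<open>b\<close> the linear term would win.\<close>

lemma linear_coeff_zero:
  fixes b c :: real
  assumes "\<And>t. 0 \<le> t * b + t\<^sup>2 * c"
  shows "b = 0"
proof (rule ccontr)
  assume "b \<noteq> 0"
  \<comment> \<open>A positive upper bound of \<open>c\<close>; the quadratic with \<open>k\<close>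
    in place of \<open>c\<close> has its minimum at \<open>- b / (2 * k)\<close>, where it is
    negative.\<close>
  define k where "k = \<bar>c\<bar> + 1"
  have k: "k > 0" "c \<le> k" by (auto simp: k_def)
  have "0 \<le> (- b / (2 * k)) * b + (- b / (2 * k))\<^sup>2 * c" by (rule assms)
  also have "\<dots> \<le> (- b / (2 * k)) * b + (- b / (2 * k))\<^sup>2 * k"
    using k(2) by (intro add_left_mono mult_left_mono) auto
  also have "\<dots> = - (b\<^sup>2 / (4 * k))"
    using k(1) by (simp add: power2_eq_square field_simps)
  also have "\<dots> < 0" using k(1) \<open>b \<noteq> 0\<close> by simp
  finally show False by simp
qed

section \<open>Distances and the two sides of an edge\<close>

context ftree begin

text \<open>The walk must cross the edge from \<open>y\<close> to \<open>z\<close>; stopping just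
  before the crossing makes it shorter.\<close>

lemma awalk_through:
  assumes "awalk x p z" "x \<in> Cmp y z" "(y, z) \<in> E"
  shows "\<exists>q. awalk x q y \<and> length q < length p"
  using assms(1,2)
proof (induction p arbitrary: x)
  case Nil
  then show ?case using root_notin_Cmp[OF assms(3)] by (simp add: awalk_Nil_iff)
next
  case (Cons e p)
  then have e: "e \<in> arcs G" "tail G e = x" and w: "awalk (head G e) p z"
    by (auto simp: awalk_Cons_iff)
  have "(x, head G e) \<in> E" using e by (auto simp: arcs_ends_conv)
  from Cmp_closed[OF Cons.prems(2) this assms(3)] show ?case
  proof
    assume "head G e \<in> Cmp y z"
    from Cons.IH[OF w this] obtain q where "awalk (head G e) q y" "length q < length p" by blast
    then have "awalk x (e # q) y" "length (e # q) < length (e # p)"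
      using e by (auto simp: awalk_Cons_iff)
    then show ?thesis by blast
  next
    assume "head G e = z \<and> x = y"
    then have "awalk x [] y" using E_verts(1)[OF assms(3)] by (simp add: awalk_Nil_iff)
    then show ?thesis by (metis length_greater_0_conv list.distinct(1) list.size(3))
  qed
qed

lemma awalk_cost_one: "awalk_cost (\<lambda>_. 1) p = real (length p)"
  by (induction p) auto

lemma graph_dist_less:
  assumes yz: "(y, z) \<in> E" and x: "x \<in> Cmp y z"
  shows "graph_dist G x y < graph_dist G x z"
proof -
  have xV: "x \<in> V" using x Cmp_subset E_verts(1)[OF yz] by blast
  have "x \<rightarrow>\<^sup>* y" using E_rtrancl[OF xV E_verts(1)[OF yz]] reachable_conv'[OF xV] by blast
  then obtain p where "awalk x p y" using reachable_awalk by blast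
  then have "graph_dist G x y \<le> ereal (real (length p))"
    using min_cost_le_walk_cost[of x p y "\<lambda>_. 1"] by (simp add: graph_dist_def awalk_cost_one)
  \<comment> \<open>Distances are extended reals, and adding 1 increases them strictly only when
    they are finite.\<close>
  then have fin1: "graph_dist G x y \<noteq> \<infinity>" by auto
  have "0 \<le> graph_dist G x y"
    by (auto simp: graph_dist_def \<mu>_def awalk_cost_one intro!: INF_greatest)
  then have fin2: "graph_dist G x y \<noteq> -\<infinity>" by auto
  have "graph_dist G x y + 1 \<le> graph_dist G x z"
    unfolding graph_dist_def[of G x z] \<mu>_def
  proof (rule INF_greatest)
    fix p assume "p \<in> {p. awalk x p z}"
    then obtain q where q: "awalk x q y" "length q < length p"
      using awalk_through[OF _ x yz] by blast
    have "graph_dist G x y \<le> ereal (real (length q))"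
      using min_cost_le_walk_cost[OF q(1), of "\<lambda>_. 1"] by (simp add: graph_dist_def awalk_cost_one)
    then have "graph_dist G x y + 1 \<le> ereal (real (length q)) + 1"
      by (rule add_right_mono)
    also have "\<dots> \<le> ereal (awalk_cost (\<lambda>_. 1) p)"
      using q(2) by (simp add: awalk_cost_one)
    finally show "graph_dist G x y + 1 \<le> ereal (awalk_cost (\<lambda>_. 1) p)" .
  qed
  moreover have "graph_dist G x y < graph_dist G x y + 1"
    using fin1 fin2 by (cases "graph_dist G x y") auto
  ultimately show ?thesis by simp
qed

text \<open>Translates the monotonicity condition in \<open>Sigma_set\<close> into one about
  components.\<close>

lemma graph_dist_less_iff:
  assumes yz: "(y, z) \<in> E" and x: "x \<in> V"
  shows "graph_dist G x z < graph_dist G x y \<longleftrightarrow> x \<notin> Cmp y z"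
  using graph_dist_less[OF yz] graph_dist_less[OF E_sym[OF yz]] Cmp_compl[OF yz x]
  by (metis less_asym)

section \<open>Dirichlet energy\<close>

abbreviation "L \<equiv> laplacian G"

text \<open>The normal derivative is the Laplacian at a boundary vertex, so with \<open>bd\<close> the interior and the
  boundary equations become the single equation \<open>L f w = lam * bd f w\<close>.\<close>

definition bd :: "('a \<Rightarrow> real) \<Rightarrow> 'a \<Rightarrow> real" where
  "bd f w = (if w \<in> \<delta> then f w else 0)"

lemma normal_deriv_eq: assumes "w \<in> \<delta>" shows "normal_deriv G f w = L f w"
proof -
  obtain u where "N w = {u}" using assms by (auto simp: boundary_iff card_1_singleton_iff)
  then show ?thesis by (simp add: normal_deriv_def laplacian_def)
qed

text \<open>The exceptional set \<open>X\<close> is empty for eigenfunctions and \<open>{x}\<close>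
  for flows to \<open>x\<close>.\<close>

lemma steklov_equations_iff:
  "(\<forall>w\<in>interior_verts G - X. L f w = 0) \<and> (\<forall>w\<in>\<delta> - X. normal_deriv G f w = lam * f w)
    \<longleftrightarrow> (\<forall>w\<in>V - X. L f w = lam * bd f w)"
  using boundary_subset by (auto simp: normal_deriv_eq interior_verts_def bd_def)

lemma sum_bd: "(\<Sum>w\<in>V. h w * bd f w) = (\<Sum>w\<in>\<delta>. h w * f w)"
  by (rule sum.mono_neutral_cong_right) (auto simp: bd_def boundary_subset[THEN subsetD])

text \<open>The Dirichlet form; the factor 1/2 is there because each edge occurs as two
  arcs.\<close>

definition energy :: "('a \<Rightarrow> real) \<Rightarrow> ('a \<Rightarrow> real) \<Rightarrow> real" where
  "energy f h = (\<Sum>(u, v)\<in>E. (f u - f v) * (h u - h v)) / 2"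

lemma E_Sigma: "E = Sigma V N"
  by (auto simp: N_iff dest: E_verts)

text \<open>Summation by parts: reversing all arcs exchanges \<open>h u\<close> and
  \<open>h v\<close> at the cost of a sign.\<close>

lemma green: "energy f h = (\<Sum>w\<in>V. h w * L f w)"
proof -
  have 1: "(\<Sum>(u, v)\<in>E. (f u - f v) * h u) = (\<Sum>w\<in>V. h w * L f w)"
    unfolding E_Sigma laplacian_def
    by (subst sum.Sigma[symmetric]) (auto simp: finite_N sum_distrib_left mult.commute)
  have "(\<Sum>(u, v)\<in>E. (f u - f v) * h v) = (\<Sum>(u, v)\<in>E. (f v - f u) * h u)"
    by (rule sum.reindex_bij_witness[of _ prod.swap prod.swap]) (auto intro: E_sym)
  also have "\<dots> = - (\<Sum>w\<in>V. h w * L f w)"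
    unfolding 1[symmetric] sum_negf[symmetric] by (rule sum.cong) (auto simp: algebra_simps)
  finally have 2: "(\<Sum>(u, v)\<in>E. (f u - f v) * h v) = - (\<Sum>w\<in>V. h w * L f w)" .
  have "(\<Sum>(u, v)\<in>E. (f u - f v) * (h u - h v))
      = (\<Sum>(u, v)\<in>E. (f u - f v) * h u) - (\<Sum>(u, v)\<in>E. (f u - f v) * h v)"
    unfolding sum_subtractf[symmetric] by (rule sum.cong) (auto simp: algebra_simps)
  then show ?thesis by (simp add: energy_def 1 2)
qed

lemma energy_commute: "energy f h = energy h f"
  by (simp add: energy_def mult.commute)

lemma energy_linear: "energy (\<lambda>w. a * f w + b * g w) h = a * energy f h + b * energy g h"
  unfolding energy_def sum_distrib_left add_divide_distrib[symmetric] sum_divide_distrib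
    sum.distrib[symmetric]
  by (rule sum.cong) (auto simp: algebra_simps add_divide_distrib diff_divide_distrib)

lemma energy_square_add: "energy (\<lambda>w. a * f w + b * g w) (\<lambda>w. a * f w + b * g w)
    = a\<^sup>2 * energy f f + 2 * a * b * energy f g + b\<^sup>2 * energy g g"
  unfolding energy_linear energy_commute[of _ "\<lambda>w. a * f w + b * g w"]
  by (simp add: energy_commute[of g f] power2_eq_square algebra_simps)

lemma energy_shift: "energy (\<lambda>w. f w - c) (\<lambda>w. h w - d) = energy f h"
  by (simp add: energy_def)

lemma energy_cong:
  "(\<And>w. w \<in> V \<Longrightarrow> f w = f' w) \<Longrightarrow> (\<And>w. w \<in> V \<Longrightarrow> h w = h' w) \<Longrightarrow> energy f h = energy f' h'"
  unfolding energy_def by (intro arg_cong2[where f="(/)"] sum.cong) (auto dest: E_verts)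

lemma energy_nonneg: "0 \<le> energy f f"
  unfolding energy_def by (auto intro!: sum_nonneg)

lemma energy_arc: assumes "(u, v) \<in> E" shows "(f u - f v)\<^sup>2 \<le> energy f f"
proof -
  have "u \<noteq> v" using assms E_irrefl by blast
  then have "2 * (f u - f v)\<^sup>2 = (\<Sum>(u, v)\<in>{(u, v), (v, u)}. (f u - f v) * (f u - f v))"
    by (simp add: power2_eq_square algebra_simps)
  also have "\<dots> \<le> (\<Sum>(u, v)\<in>E. (f u - f v) * (f u - f v))"
    using assms E_sym finite_E by (intro sum_mono2) auto
  finally show ?thesis by (simp add: energy_def)
qed

lemma energy_0_const:
  assumes "energy f f = 0" "u \<in> V" "v \<in> V" shows "f u = f v"
proof -
  have "(u, v) \<in> E\<^sup>*" using assms(2,3) by (rule E_rtrancl)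
  then show ?thesis
  proof induction
    case (step a b)
    then show ?case using energy_arc[of a b f] assms(1) by simp
  qed simp
qed

lemma energy_abs: "energy (\<lambda>w. \<bar>f w\<bar>) (\<lambda>w. \<bar>f w\<bar>) \<le> energy f f"
proof -
  have "(\<bar>a\<bar> - \<bar>b\<bar>) * (\<bar>a\<bar> - \<bar>b\<bar>) \<le> (a - b) * (a - b)" for a b :: real
    using abs_le_square_iff[of "\<bar>a\<bar> - \<bar>b\<bar>" "a - b"] by (auto simp: power2_eq_square abs_triangle_ineq3)
  then show ?thesis unfolding energy_def by (intro divide_right_mono sum_mono) auto
qed

text \<open>Direct method: normalize on \<open>D\<close> and minimize over a compact set. It is
  applied with \<open>D\<close> the boundary and \<open>C\<close> given by a zero at a vertex or by
  mean zero. The assumption \<open>cong\<close> allows values outside \<open>V\<close> to be set to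
  0.\<close>

lemma minimizer_exists:
  assumes D: "D \<subseteq> V" and closed: "closed C"
    and scale: "\<And>f c. f \<in> C \<Longrightarrow> (\<lambda>w. c * f w) \<in> C"
    and cong: "\<And>f g. f \<in> C \<Longrightarrow> (\<And>w. w \<in> V \<Longrightarrow> f w = g w) \<Longrightarrow> g \<in> C"
    and f0: "f0 \<in> C" "w0 \<in> D" "f0 w0 \<noteq> 0"
  obtains f where "f \<in> C" "(\<Sum>w\<in>D. (f w)\<^sup>2) = 1"
    and "\<And>g. g \<in> C \<Longrightarrow> energy f f * (\<Sum>w\<in>D. (g w)\<^sup>2) \<le> energy g g"
proof -
  have finD: "finite D" by (rule finite_subset[OF D finite_verts])
  define S where "S f = (\<Sum>w\<in>D. (f w)\<^sup>2)" for f :: "'a \<Rightarrow> real"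
  define nrm where "nrm f w = (if w \<in> V then f w / sqrt (S f) else 0)" for f :: "'a \<Rightarrow> real" and w
  have S_pos: "S f > 0" if "w \<in> D" "f w \<noteq> 0" for f w
    unfolding S_def using finD that by (intro sum_pos2[of D w]) auto
  have nrm: "nrm f \<in> C" "S (nrm f) = 1" "energy (nrm f) (nrm f) = energy f f / S f"
    if "f \<in> C" "S f > 0" for f
  proof -
    have "(\<lambda>w. (1 / sqrt (S f)) * f w) \<in> C" using that scale by blast
    then show "nrm f \<in> C" by (rule cong) (auto simp: nrm_def)
    have "(nrm f w)\<^sup>2 = (f w)\<^sup>2 / S f" if "w \<in> D" for w
      using that \<open>S f > 0\<close> D by (auto simp: nrm_def power_divide)
    then have "S (nrm f) = (\<Sum>w\<in>D. (f w)\<^sup>2 / S f)"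
      unfolding S_def[of "nrm f"] by (rule sum.cong[OF refl])
    also have "\<dots> = S f / S f"
      by (simp add: sum_divide_distrib[symmetric] S_def)
    finally have "S (nrm f) = S f / S f" .
    then show "S (nrm f) = 1" using that(2) by simp
    have "energy (nrm f) (nrm f) = energy (\<lambda>w. (1 / sqrt (S f)) * f w + 0 * f w) (\<lambda>w. (1 / sqrt (S f)) * f w + 0 * f w)"
      by (rule energy_cong) (auto simp: nrm_def)
    also have "\<dots> = energy f f / S f"
      unfolding energy_square_add using that(2) by (simp add: power_divide)
    finally show "energy (nrm f) (nrm f) = energy f f / S f" .
  qed
  have S_f0: "S f0 > 0" using f0 S_pos by blast
  define M where "M = energy (nrm f0) (nrm f0)"
  have M: "M \<ge> 0" by (simp add: M_def energy_nonneg)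
  \<comment> \<open>A bound for each vertex, propagated from \<open>w0\<close>: there the
    normalization gives 1, and crossing an edge adds at most \<open>sqrt M\<close>.\<close>
  have "\<exists>B. \<forall>f. S f = 1 \<longrightarrow> energy f f \<le> M \<longrightarrow> \<bar>f w\<bar> \<le> B" if "w \<in> V" for w
  proof -
    have "(w0, w) \<in> E\<^sup>*" using E_rtrancl f0 D that by blast
    then show ?thesis
    proof induction
      case base
      have "\<bar>f w0\<bar> \<le> 1" if "S f = 1" for f
      proof -
        have "(f w0)\<^sup>2 \<le> S f" unfolding S_def by (rule member_le_sum) (use finD f0 in auto)
        then show ?thesis using that by (simp add: abs_square_le_1)
      qed
      then show ?case by blast
    next
      case (step a b)
      then obtain B where B: "\<And>f. S f = 1 \<Longrightarrow> energy f f \<le> M \<Longrightarrow> \<bar>f a\<bar> \<le> B" by blast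
      have "\<bar>f b\<bar> \<le> B + sqrt M" if "S f = 1" "energy f f \<le> M" for f
      proof -
        have "(f a - f b)\<^sup>2 \<le> M" using energy_arc[OF step(2), of f] that by simp
        then have "\<bar>f a - f b\<bar> \<le> sqrt M" using real_le_rsqrt by fastforce
        then show ?thesis using B[OF that] by linarith
      qed
      then show ?case by blast
    qed
  qed
  then obtain B where B: "\<And>w f. w \<in> V \<Longrightarrow> S f = 1 \<Longrightarrow> energy f f \<le> M \<Longrightarrow> \<bar>f w\<bar> \<le> B w"
    by metis
  \<comment> \<open>Compact by Tychonoff; the factor \<open>{0}\<close> outside \<open>V\<close> is
    why \<open>nrm\<close> vanishes there.\<close>
  define P where "P = PiE UNIV (\<lambda>w. if w \<in> V then {- B w..B w} else {0::real})"
  have "compactin (product_topology (\<lambda>i. euclidean) UNIV) P"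
    unfolding P_def compactin_PiE by auto
  then have P: "compact P"
    by (simp add: euclidean_product_topology)
  define K where "K = P \<inter> (C \<inter> {f. S f = 1} \<inter> {f. energy f f \<le> M})"
  have cS: "continuous_on UNIV S" unfolding S_def by (intro continuous_intros) auto
  have cE: "continuous_on X (\<lambda>f. energy f f)" for X
    unfolding energy_def case_prod_unfold
    by (intro continuous_intros continuous_on_subset[OF continuous_on_product_coordinates]) auto
  have cK: "compact K"
    unfolding K_def
    by (intro compact_Int_closed P closed_Int closed closed_Collect_eq closed_Collect_le cS cE
        continuous_intros)
  have K: "nrm f \<in> K" if "f \<in> C" "S f > 0" "energy (nrm f) (nrm f) \<le> M" for f
  proof -
    have "\<bar>nrm f w\<bar> \<le> B w" if "w \<in> V" for w
      using B[OF that nrm(2)[OF \<open>f \<in> C\<close> \<open>S f > 0\<close>]] \<open>energy (nrm f) (nrm f) \<le> M\<close> by blast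
    then have "- B w \<le> nrm f w \<and> nrm f w \<le> B w" if "w \<in> V" for w
      using that by (simp add: abs_le_iff minus_le_iff)
    moreover have "nrm f w = 0" if "w \<notin> V" for w
      using that by (simp add: nrm_def)
    ultimately have "nrm f \<in> P" by (simp add: P_def PiE_def Pi_def)
    then show ?thesis using nrm(1,2)[OF that(1,2)] that(3) by (simp add: K_def)
  qed
  have "K \<noteq> {}" using K[OF f0(1) S_f0] by (auto simp: M_def)
  from continuous_attains_inf[OF cK this cE]
  obtain f where f: "f \<in> K" "\<And>g. g \<in> K \<Longrightarrow> energy f f \<le> energy g g" by blast
  have fC: "f \<in> C" "S f = 1" "energy f f \<le> M" using f(1) by (auto simp: K_def)
  have "energy f f * S g \<le> energy g g" if g: "g \<in> C" for g
  proof (cases "S g > 0")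
    case True
    have "energy f f \<le> energy (nrm g) (nrm g)"
    \<comment> \<open>A competitor with energy above \<open>M\<close> is outside \<open>K\<close>,
      but the minimizer has energy at most \<open>M\<close> anyway.\<close>
    proof (cases "energy (nrm g) (nrm g) \<le> M")
      case le: True
      show ?thesis by (rule f(2)[OF K[OF g True le]])
    qed (use fC in simp)
    then show ?thesis using True by (simp add: nrm[OF g True] field_simps)
  next
    case False
    then have "S g = 0" unfolding S_def by (metis antisym_conv2 sum_nonneg zero_le_power2)
    then show ?thesis by (simp add: energy_nonneg)
  qed
  then show ?thesis using that[OF fC(1)] fC(2) unfolding S_def by blast
qed

end

text \<open>Bessel's inequality for the unit vector at each point of \<open>D\<close>, summed over
  \<open>D\<close>.\<close>

lemma card_orthonormal_le:
  fixes v :: "'i \<Rightarrow> 'a \<Rightarrow> real"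
  assumes D: "finite D" and F: "finite F"
    and unit: "\<And>i. i \<in> F \<Longrightarrow> (\<Sum>w\<in>D. (v i w)\<^sup>2) = 1"
    and orth: "\<And>i j. i \<in> F \<Longrightarrow> j \<in> F \<Longrightarrow> i \<noteq> j \<Longrightarrow> (\<Sum>w\<in>D. v i w * v j w) = 0"
  shows "card F \<le> card D"
proof -
  have bessel: "(\<Sum>i\<in>F. (v i d)\<^sup>2) \<le> 1" if d: "d \<in> D" for d
  proof -
    \<comment> \<open>\<open>p\<close> is the projection of the unit vector at \<open>d\<close> to the span of \<open>v\<close>\<close>
    define p where "p w = (\<Sum>i\<in>F. v i d * v i w)" for w
    have "(\<Sum>w\<in>D. (p w)\<^sup>2) = (\<Sum>i\<in>F. \<Sum>j\<in>F. v i d * v j d * (\<Sum>w\<in>D. v i w * v j w))"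
      unfolding p_def power2_eq_square sum_product sum_distrib_left
      by (subst sum.swap, rule sum.cong[OF refl], subst sum.swap)
        (auto intro!: sum.cong simp: sum_distrib_left sum_distrib_right mult_ac)
    also have "\<dots> = (\<Sum>i\<in>F. \<Sum>j\<in>F. if j = i then (v i d)\<^sup>2 else 0)"
    proof (intro sum.cong refl)
      fix i j assume "i \<in> F" "j \<in> F"
      then show "v i d * v j d * (\<Sum>w\<in>D. v i w * v j w) = (if j = i then (v i d)\<^sup>2 else 0)"
        using unit[of i] orth[of i j] by (auto simp: power2_eq_square)
    qed
    also have "\<dots> = p d" using F by (simp add: p_def power2_eq_square)
    finally have pp: "(\<Sum>w\<in>D. (p w)\<^sup>2) = p d" .
    have "0 \<le> (\<Sum>w\<in>D. (of_bool (w = d) - p w)\<^sup>2)" by (simp add: sum_nonneg)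
    also have "\<dots> = (\<Sum>w\<in>D. of_bool (w = d) - 2 * (if w = d then p w else 0) + (p w)\<^sup>2)"
      by (rule sum.cong) (auto simp: power2_eq_square algebra_simps)
    also have "\<dots> = 1 - p d"
      using D d pp by (simp add: sum.distrib sum_subtractf sum_distrib_left[symmetric] of_bool_def)
    finally show ?thesis by (simp add: p_def power2_eq_square)
  qed
  have "real (card F) = (\<Sum>i\<in>F. \<Sum>w\<in>D. (v i w)\<^sup>2)" using unit by simp
  also have "\<dots> = (\<Sum>w\<in>D. \<Sum>i\<in>F. (v i w)\<^sup>2)" by (rule sum.swap)
  also have "\<dots> \<le> (\<Sum>w\<in>D. 1)" by (rule sum_mono) (rule bessel)
  finally show ?thesis by simp
qed

lemma sum_times_of_bool_eq:
  "finite A \<Longrightarrow> (\<Sum>v\<in>A. f v * of_bool (v = w)) = (if w \<in> A then f w else (0::real))"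
  by (simp add: of_bool_def if_distrib[where f="\<lambda>x. _ * x"] cong: if_cong)

lemma sum_shift_square:
  assumes "finite D" "(\<Sum>w\<in>D. f w) = 0"
  shows "(\<Sum>w\<in>D. (f w - c)\<^sup>2) = (\<Sum>w\<in>D. (f w)\<^sup>2) + real (card D) * (c::real)\<^sup>2"
proof -
  have "(\<Sum>w\<in>D. (f w - c)\<^sup>2) = (\<Sum>w\<in>D. (f w)\<^sup>2 - 2 * c * f w + c\<^sup>2)"
    by (rule sum.cong) (auto simp: power2_eq_square algebra_simps)
  then show ?thesis using assms by (simp add: sum.distrib sum_subtractf sum_distrib_left[symmetric])
qed

context ftree begin

lemma energy_eigen:
  assumes "\<And>w. w \<in> V - X \<Longrightarrow> L f w = lam * bd f w" "\<And>w. w \<in> X \<Longrightarrow> h w = 0"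
  shows "energy f h = lam * (\<Sum>w\<in>\<delta>. f w * h w)"
proof -
  have "energy f h = (\<Sum>w\<in>V. h w * (lam * bd f w))"
    unfolding green using assms by (intro sum.cong) auto
  also have "\<dots> = lam * (\<Sum>w\<in>V. h w * bd f w)"
    by (simp add: sum_distrib_left mult.left_commute)
  finally show ?thesis by (simp add: sum_bd mult.commute)
qed

lemma energy_indicator:
  assumes "w \<in> V" shows "energy f (\<lambda>v. of_bool (v = w)) = L f w"
  using assms sum_times_of_bool_eq[OF finite_verts, of "L f" w] by (simp add: green mult.commute)

text \<open>The weak Euler-Lagrange equation: energy minus \<open>m\<close> times the square sum,
  along \<open>f + t h\<close>, is a nonnegative quadratic in \<open>t\<close> that vanishes at
  0.\<close>

lemma stationary:
  assumes min: "energy f f = m * (\<Sum>w\<in>D. (f w)\<^sup>2)"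
    and le: "\<And>t. m * (\<Sum>w\<in>D. (f w + t * h w)\<^sup>2) \<le> energy (\<lambda>w. f w + t * h w) (\<lambda>w. f w + t * h w)"
  shows "energy f h = m * (\<Sum>w\<in>D. f w * h w)"
proof -
  let ?b = "2 * (energy f h - m * (\<Sum>w\<in>D. f w * h w))"
  let ?c = "energy h h - m * (\<Sum>w\<in>D. (h w)\<^sup>2)"
  have "?b = 0"
  proof (rule linear_coeff_zero)
    fix t
    have "(\<Sum>w\<in>D. (f w + t * h w)\<^sup>2)
        = (\<Sum>w\<in>D. (f w)\<^sup>2) + 2 * t * (\<Sum>w\<in>D. f w * h w) + t\<^sup>2 * (\<Sum>w\<in>D. (h w)\<^sup>2)"
      unfolding sum_distrib_left sum.distrib[symmetric]
      by (rule sum.cong) (auto simp: power2_eq_square algebra_simps)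
    moreover have "energy (\<lambda>w. f w + t * h w) (\<lambda>w. f w + t * h w)
        = energy f f + 2 * t * energy f h + t\<^sup>2 * energy h h"
      using energy_square_add[of 1 f t h] by simp
    ultimately show "0 \<le> t * ?b + t\<^sup>2 * ?c"
      using le[of t] min by (simp add: algebra_simps)
  qed
  then show ?thesis by simp
qed

section \<open>Dirichlet eigenvalue at a boundary vertex\<close>

lemma boundary_nonempty: "\<delta> \<noteq> {}"
  using two_le_card_boundary by auto

lemma boundary_minus_nonempty: "\<delta> - {x} \<noteq> {}"
proof
  assume "\<delta> - {x} = {}"
  then have "card \<delta> \<le> card {x}" by (intro card_mono) auto
  then show False using two_le_card_boundary by simp
qed

text \<open>Minimum principle: at a zero of \<open>g\<close> other than \<open>x\<close> the
  Laplacian vanishes, so all neighbours are zeros too. Zeros spread over all of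
  \<open>V - {x}\<close>, which is connected because \<open>x\<close> is a leaf.\<close>

lemma nonneg_eigen_pos:
  assumes x: "x \<in> \<delta>" and g: "\<And>w. g w \<ge> 0"
    and eig: "\<And>w. w \<in> V - {x} \<Longrightarrow> L g w = m * bd g w"
    and nz: "w0 \<in> V - {x}" "g w0 \<noteq> 0" and w: "w \<in> V - {x}"
  shows "g w > 0"
proof (rule ccontr)
  assume "\<not> g w > 0"
  then have 0: "g w = 0" using g[of w] by simp
  obtain y where y: "(x, y) \<in> E" using neighbor_exists x boundary_subset by blast
  have xV: "x \<in> V" using x boundary_subset by blast
  have side: "v \<in> Cmp y x" if v: "v \<in> V - {x}" for v
  proof -
    obtain z where z: "(x, z) \<in> E" "v \<in> Cmp z x"
      using Cmp_towards[of v x] v xV by auto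
    then show ?thesis using boundary_neighbors[OF x y] by (auto simp: N_iff)
  qed
  have "(w, w0) \<in> (Cut y x)\<^sup>*"
    using side[OF w] side[OF nz(1)] Cut_rtrancl_sym unfolding Cmp_def by (blast intro: rtrancl_trans)
  then have "g w0 = 0 \<and> w0 \<in> Cmp y x"
  proof induction
    case base then show ?case using 0 side[OF w] by simp
  next
    case (step a b)
    have ab: "(a, b) \<in> E" using step(2) by (simp add: Cut_def)
    have "a \<in> V" "a \<noteq> x" using E_verts[OF ab] step(3) root_notin_Cmp[OF E_sym[OF y]] by auto
    then have "L g a = 0" using eig[of a] step(3) by (simp add: bd_def)
    then have "(\<Sum>u\<in>N a. g u) = 0" using step(3) by (simp add: laplacian_def sum_negf)
    then have "g b = 0" using g ab by (simp add: sum_nonneg_eq_0_iff finite_N N_iff)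
    moreover have "b \<in> Cmp y x" using step(2,3) by (auto simp: Cmp_def intro: rtrancl_into_rtrancl)
    ultimately show ?case by simp
  qed
  then show False using nz by simp
qed

lemma dirichlet_minimizer:
  assumes x: "x \<in> \<delta>"
  obtains m g where "m > 0" "g x = 0" "\<And>w. w \<in> V - {x} \<Longrightarrow> g w > 0"
    "\<And>w. w \<in> V - {x} \<Longrightarrow> L g w = m * bd g w"
    "\<And>f. f x = 0 \<Longrightarrow> m * (\<Sum>w\<in>\<delta>. (f w)\<^sup>2) \<le> energy f f"
proof -
  have xV: "x \<in> V" using x boundary_subset by blast
  obtain w0 where w0: "w0 \<in> \<delta>" "w0 \<noteq> x" using boundary_minus_nonempty[of x] by blast
  obtain f where f: "f x = 0" "(\<Sum>w\<in>\<delta>. (f w)\<^sup>2) = 1"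
    and min: "\<And>g. g x = 0 \<Longrightarrow> energy f f * (\<Sum>w\<in>\<delta>. (g w)\<^sup>2) \<le> energy g g"
  proof (rule minimizer_exists[of \<delta> "{f. f x = 0}" "\<lambda>w. of_bool (w = w0)" w0])
    show "closed {f :: 'a \<Rightarrow> real. f x = 0}"
      by (intro closed_Collect_eq continuous_intros continuous_on_product_coordinates)
  qed (use boundary_subset w0 xV in auto)
  \<comment> \<open>The absolute value keeps the boundary squares and does not raise the energy, so
    it is again a minimizer, now nonnegative.\<close>
  define g where "g w = \<bar>f w\<bar>" for w
  define m where "m = energy f f"
  have g: "g x = 0" "(\<Sum>w\<in>\<delta>. (g w)\<^sup>2) = 1" "\<And>w. g w \<ge> 0"
    using f by (auto simp: g_def)
  have "energy g g = m"
    using energy_abs[of f] min[of g] g by (simp add: g_def[abs_def] m_def)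
  have gh: "energy g h = m * (\<Sum>w\<in>\<delta>. g w * h w)" if "h x = 0" for h
    by (rule stationary) (use \<open>energy g g = m\<close> g that min m_def in auto)
  have eig: "L g w = m * bd g w" if w: "w \<in> V - {x}" for w
  proof -
    have "L g w = energy g (\<lambda>v. of_bool (v = w))" using w by (simp add: energy_indicator)
    also have "\<dots> = m * (\<Sum>v\<in>\<delta>. g v * of_bool (v = w))" by (rule gh) (use w in auto)
    also have "(\<Sum>v\<in>\<delta>. g v * of_bool (v = w)) = bd g w"
      by (simp add: bd_def sum_times_of_bool_eq finite_boundary)
    finally show ?thesis .
  qed
  obtain w1 where w1: "w1 \<in> \<delta>" "g w1 \<noteq> 0"
    using g(2) by (metis sum.neutral zero_neq_one zero_power2)
  then have w1': "w1 \<in> V - {x}" using g(1) boundary_subset by auto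
  have pos: "g w > 0" if "w \<in> V - {x}" for w
    by (rule nonneg_eigen_pos[OF x g(3) eig w1' w1(2) that])
  have "m \<noteq> 0"
  proof
    assume "m = 0"
    then have "g w1 = g x" using \<open>energy g g = m\<close> w1' xV by (intro energy_0_const) auto
    then show False using w1 g by simp
  qed
  then have "m > 0" using energy_nonneg[of f] by (simp add: m_def)
  then show thesis using that[of m g] g(1) pos eig min by (simp add: m_def)
qed

text \<open>Induction from the leaves: the drop from \<open>y\<close> to \<open>z\<close> is the
  source \<open>m * bd g y\<close> plus the drops from the children to \<open>y\<close>. A leaf has
  a positive source, an interior vertex at least one child.\<close>

lemma eigen_increasing:
  assumes "m > 0" and pos: "\<And>w. w \<in> V - {x} \<Longrightarrow> g w > 0"
    and eig: "\<And>w. w \<in> V - {x} \<Longrightarrow> L g w = m * bd g w"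
    and "(y, z) \<in> E" "x \<notin> Cmp y z"
  shows "g z < g y"
  using assms(4,5)
proof (induction rule: Cmp_induct)
  case (step y z)
  have y: "y \<in> V - {x}" using step self_in_Cmp E_verts by blast
  have N: "N y = insert z (N y - {z})" using step(1) by (auto simp: N_iff)
  have "L g y = (g y - g z) + (\<Sum>u\<in>N y - {z}. g y - g u)"
    unfolding laplacian_def by (subst N, subst sum.insert) (auto simp: finite_N)
  then have eq: "g y - g z = m * bd g y + (\<Sum>u\<in>N y - {z}. g u - g y)"
    using eig[OF y] by (simp add: sum_subtractf algebra_simps)
  have child: "g y < g u" if "u \<in> N y - {z}" for u
  proof -
    have "Cmp u y \<subset> Cmp y z"
      using that step(1) by (intro Cmp_child_psubset) (auto simp: N_iff intro: E_sym)
    then show ?thesis using step(2)[OF that] step(3) by blast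
  qed
  show ?case
  proof (cases "y \<in> \<delta>")
    case True
    then have "N y - {z} = {}" using boundary_neighbors[OF True step(1)] by simp
    then have "g y - g z = m * g y" using eq True by (simp only: sum.empty) (simp add: bd_def)
    then show ?thesis using mult_pos_pos[OF \<open>m > 0\<close> pos[OF y]] by simp
  next
    case False
    have "(\<Sum>u\<in>N y - {z}. g u - g y) > 0"
      using child notin_boundary_neighbors[OF step(1) False] by (intro sum_pos) (auto simp: finite_N)
    then show ?thesis using eq False by (simp add: bd_def)
  qed
qed

text \<open>Where \<open>f\<close> is minimal on \<open>V - {x}\<close>, the neighbour towards
  \<open>x\<close> has a smaller value, so it is \<open>x\<close> itself and the minimum exceeds
  \<open>f x = 0\<close>.\<close>

lemma increasing_pos:
  assumes x: "x \<in> V" and "f x = 0" and inc: "\<And>y z. (y, z) \<in> E \<Longrightarrow> x \<notin> Cmp y z \<Longrightarrow> f z < f y"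
    and w: "w \<in> V - {x}"
  shows "(f w :: real) > 0"
proof (rule ccontr)
  assume "\<not> f w > 0"
  obtain m where m: "m \<in> V - {x}" "\<And>v. v \<in> V - {x} \<Longrightarrow> f m \<le> f v"
    using ex_is_arg_min_if_finite[of "V - {x}" f] w by (auto simp: is_arg_min_linorder)
  obtain z where z: "(m, z) \<in> E" "x \<in> Cmp z m" using Cmp_towards[OF x] m by blast
  have "f z < f m"
    using inc[OF z(1)] Cmp_compl[OF z(1) x] z(2) by blast
  then have "z = x" using m(2)[of z] E_verts[OF z(1)] by force
  then have "0 < f m" using \<open>f z < f m\<close> \<open>f x = 0\<close> by simp
  then show False using m(2)[OF w] \<open>\<not> f w > 0\<close> by simp
qed

text \<open>Uniqueness comes from symmetry of the energy: for solutions \<open>f\<close>,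
  \<open>g\<close> with parameters \<open>lam\<close>, \<open>m\<close> it gives
  \<open>lam * S = m * S\<close>, where \<open>S\<close> is the boundary sum of
  \<open>f w * g w\<close>, and positivity of both makes \<open>S\<close> positive.\<close>

lemma Sigma_set_eq:
  assumes x: "x \<in> \<delta>" and "m > 0" "g x = 0" and pos: "\<And>w. w \<in> V - {x} \<Longrightarrow> g w > 0"
    and eig: "\<And>w. w \<in> V - {x} \<Longrightarrow> L g w = m * bd g w"
  shows "Sigma_set G x = {m}"
proof -
  have xV: "x \<in> V" using x boundary_subset by blast
  obtain w0 where w0: "w0 \<in> \<delta> - {x}" using boundary_minus_nonempty[of x] by blast
  then have w0V: "w0 \<in> V - {x}" using boundary_subset by blast
  have "is_flow G x m g"
    unfolding is_flow_def steklov_equations_iff using eig pos[OF w0V] w0V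
    by (auto intro!: bexI[of _ w0])
  moreover have "g y - g z > 0" if "(y, z) \<in> E" "graph_dist G x z < graph_dist G x y" for y z
    using eigen_increasing[of m x g, OF \<open>m > 0\<close> pos eig] that graph_dist_less_iff xV by auto
  ultimately have "m \<in> Sigma_set G x"
    using \<open>m > 0\<close> \<open>g x = 0\<close> by (auto simp: Sigma_set_def)
  moreover have "lam = m" if "lam \<in> Sigma_set G x" for lam
  proof -
    have "\<exists>f. is_flow G x lam f \<and> f x = 0 \<and>
        (\<forall>y z. (y, z) \<in> E \<and> graph_dist G x z < graph_dist G x y \<longrightarrow> 0 < f y - f z)"
      using that unfolding Sigma_set_def by blast
    then obtain f where f: "is_flow G x lam f" "f x = 0"
      and inc: "\<And>y z. (y, z) \<in> E \<Longrightarrow> graph_dist G x z < graph_dist G x y \<Longrightarrow> f z < f y"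
      by auto
    have eigf: "L f w = lam * bd f w" if "w \<in> V - {x}" for w
      using f(1) that unfolding is_flow_def steklov_equations_iff by blast
    have fpos: "f w > 0" if "w \<in> V - {x}" for w
      by (rule increasing_pos[where x=x]) (use xV f(2) inc graph_dist_less_iff that in auto)
    have "lam * (\<Sum>w\<in>\<delta>. f w * g w) = energy f g"
      by (rule energy_eigen[symmetric, of "{x}"]) (use eigf \<open>g x = 0\<close> in auto)
    also have "\<dots> = energy g f" by (rule energy_commute)
    also have "\<dots> = m * (\<Sum>w\<in>\<delta>. g w * f w)"
      by (rule energy_eigen[of "{x}"]) (use eig f(2) in auto)
    finally have "lam * (\<Sum>w\<in>\<delta>. f w * g w) = m * (\<Sum>w\<in>\<delta>. f w * g w)"
      by (simp add: mult.commute)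
    moreover have "(\<Sum>w\<in>\<delta>. f w * g w) > 0"
    proof (rule sum_pos2[of _ w0])
      show "0 \<le> f w * g w" if "w \<in> \<delta>" for w
        using fpos[of w] pos[of w] that boundary_subset \<open>f x = 0\<close> by (cases "w = x") (auto simp: less_imp_le)
    qed (use w0 w0V fpos pos finite_boundary in auto)
    ultimately show ?thesis by simp
  qed
  ultimately show ?thesis by blast
qed

text \<open>Replaces the infimum over flows by an attained minimum of the Rayleigh quotient; all
  later facts about \<open>sigma\<close> rest on this description.\<close>

theorem sigma_dirichlet:
  assumes x: "x \<in> \<delta>"
  obtains g where "sigma G x > 0" "g x = 0" "\<And>w. w \<in> V - {x} \<Longrightarrow> g w > 0"
    "\<And>w. w \<in> V - {x} \<Longrightarrow> L g w = sigma G x * bd g w"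
    "\<And>f. f x = 0 \<Longrightarrow> sigma G x * (\<Sum>w\<in>\<delta>. (f w)\<^sup>2) \<le> energy f f"
proof -
  obtain m g where *: "m > 0" "g x = 0" "\<And>w. w \<in> V - {x} \<Longrightarrow> g w > 0"
    "\<And>w. w \<in> V - {x} \<Longrightarrow> L g w = m * bd g w"
    "\<And>f. f x = 0 \<Longrightarrow> m * (\<Sum>w\<in>\<delta>. (f w)\<^sup>2) \<le> energy f f"
    using dirichlet_minimizer[OF x] by blast
  have "sigma G x = m" using Sigma_set_eq[OF x *(1-4)] by (simp add: sigma_def)
  then show thesis using that * by blast
qed

section \<open>Rayleigh quotient for the first nonzero eigenvalue\<close>

lemma steklov_eigenvalue_iff:
  "steklov_eigenvalue G lam \<longleftrightarrow> (\<exists>f. (\<exists>w\<in>V. f w \<noteq> 0) \<and> (\<forall>w\<in>V. L f w = lam * bd f w))"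
  using steklov_equations_iff[of "{}"] by (simp add: steklov_eigenvalue_def)

text \<open>Test the equation against the constant 1, whose energy with any function is 0.\<close>

lemma eigen_sum_boundary:
  assumes "\<And>w. w \<in> V \<Longrightarrow> L f w = lam * bd f w" "lam \<noteq> 0"
  shows "(\<Sum>w\<in>\<delta>. f w) = 0"
proof -
  have "energy f (\<lambda>_. 1) = lam * (\<Sum>w\<in>\<delta>. f w * 1)"
    by (rule energy_eigen[of "{}"]) (use assms in auto)
  then show ?thesis using assms(2) by (simp add: energy_def)
qed

lemma eigen_sum_square_pos:
  assumes eig: "\<And>w. w \<in> V \<Longrightarrow> L f w = lam * bd f w" and nz: "w0 \<in> V" "f w0 \<noteq> 0"
  shows "(\<Sum>w\<in>\<delta>. (f w)\<^sup>2) > 0"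
proof (rule ccontr)
  assume "\<not> ?thesis"
  then have 0: "(\<Sum>w\<in>\<delta>. (f w)\<^sup>2) = 0" by (metis antisym_conv2 sum_nonneg zero_le_power2)
  then have f0: "f w = 0" if "w \<in> \<delta>" for w
    using that finite_boundary by (simp add: sum_nonneg_eq_0_iff)
  have "energy f f = lam * (\<Sum>w\<in>\<delta>. f w * f w)"
    by (rule energy_eigen[of "{}"]) (use eig in auto)
  then have e0: "energy f f = 0" using 0 by (simp add: power2_eq_square)
  obtain w1 where "w1 \<in> \<delta>" using boundary_nonempty by blast
  then show False using energy_0_const[OF e0 nz(1), of w1] f0[of w1] nz boundary_subset by auto
qed

lemma eigen_orthogonal:
  assumes "\<And>w. w \<in> V \<Longrightarrow> L f w = a * bd f w" "\<And>w. w \<in> V \<Longrightarrow> L g w = b * bd g w" "a \<noteq> b"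
  shows "(\<Sum>w\<in>\<delta>. f w * g w) = 0"
proof -
  have "a * (\<Sum>w\<in>\<delta>. f w * g w) = energy f g"
    by (rule energy_eigen[symmetric, of "{}"]) (use assms in auto)
  also have "\<dots> = energy g f" by (rule energy_commute)
  also have "\<dots> = b * (\<Sum>w\<in>\<delta>. g w * f w)"
    by (rule energy_eigen[of "{}"]) (use assms in auto)
  finally show ?thesis using assms(3) by (simp add: mult.commute)
qed

text \<open>Normalized eigenfunctions for distinct eigenvalues are orthonormal on the boundary,
  which bounds their number. This makes the \<open>Min\<close> in \<open>lambda2\<close>
  meaningful.\<close>

lemma finite_eigenvalues: "finite {lam. steklov_eigenvalue G lam}"
proof (rule conjunct1[OF finite_if_finite_subsets_card_bdd])
  fix F assume F: "F \<subseteq> {lam. steklov_eigenvalue G lam}" "finite F"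
  then have "\<forall>lam\<in>F. \<exists>f. (\<exists>w\<in>V. f w \<noteq> 0) \<and> (\<forall>w\<in>V. L f w = lam * bd f w)"
    unfolding steklov_eigenvalue_iff by blast
  then obtain f where f: "\<And>lam. lam \<in> F \<Longrightarrow> \<exists>w\<in>V. f lam w \<noteq> 0"
    "\<And>lam w. lam \<in> F \<Longrightarrow> w \<in> V \<Longrightarrow> L (f lam) w = lam * bd (f lam) w"
    by metis
  define S where "S lam = (\<Sum>w\<in>\<delta>. (f lam w)\<^sup>2)" for lam
  have S: "S lam > 0" if "lam \<in> F" for lam
    using f(1)[OF that] eigen_sum_square_pos[of "f lam" lam] f(2)[OF that] by (auto simp: S_def)
  show "card F \<le> card \<delta>"
  proof (rule card_orthonormal_le[OF finite_boundary F(2), of "\<lambda>lam w. f lam w / sqrt (S lam)"])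
    fix lam assume "lam \<in> F"
    then have "(\<Sum>w\<in>\<delta>. (f lam w / sqrt (S lam))\<^sup>2) = S lam / S lam"
      using S by (simp add: power_divide sum_divide_distrib[symmetric] S_def less_imp_le)
    then show "(\<Sum>w\<in>\<delta>. (f lam w / sqrt (S lam))\<^sup>2) = 1" using S[OF \<open>lam \<in> F\<close>] by simp
  next
    fix a b assume "a \<in> F" "b \<in> F" "a \<noteq> b"
    then have "(\<Sum>w\<in>\<delta>. f a w * f b w) = 0" by (intro eigen_orthogonal[of _ a _ b] f(2))
    then have "(\<Sum>w\<in>\<delta>. f a w * f b w) / (sqrt (S a) * sqrt (S b)) = 0" by simp
    then show "(\<Sum>w\<in>\<delta>. f a w / sqrt (S a) * (f b w / sqrt (S b))) = 0"
      by (simp only: sum_divide_distrib times_divide_times_eq)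
  qed
qed

text \<open>The constraint leaves no Lagrange multiplier, because adding a constant to the test
  function changes neither the energy nor its boundary product with \<open>f\<close>.\<close>

lemma mean_zero_minimizer_eigen:
  assumes f: "(\<Sum>w\<in>\<delta>. f w) = 0" "energy f f = m * (\<Sum>w\<in>\<delta>. (f w)\<^sup>2)"
    and min: "\<And>g. (\<Sum>w\<in>\<delta>. g w) = 0 \<Longrightarrow> m * (\<Sum>w\<in>\<delta>. (g w)\<^sup>2) \<le> energy g g"
    and w: "w \<in> V"
  shows "L f w = m * bd f w"
proof -
  \<comment> \<open>The boundary mean of the indicator of \<open>w\<close>; subtracting it makes the
    variation \<open>h\<close> admissible.\<close>
  define c where "c = (\<Sum>v\<in>\<delta>. of_bool (v = w)) / real (card \<delta>)"
  define h where "h v = of_bool (v = w) - c" for v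
  have h: "(\<Sum>v\<in>\<delta>. h v) = 0"
    using boundary_nonempty finite_boundary by (simp add: h_def sum_subtractf c_def)
  have "L f w = energy f (\<lambda>v. of_bool (v = w))" using w by (simp add: energy_indicator)
  also have "\<dots> = energy f h"
    using energy_shift[of f 0 "\<lambda>v. of_bool (v = w)" c] by (simp add: h_def[abs_def])
  also have "\<dots> = m * (\<Sum>v\<in>\<delta>. f v * h v)"
  proof (rule stationary[OF f(2)])
    fix t
    have "(\<Sum>v\<in>\<delta>. f v + t * h v) = 0" using f h by (simp add: sum.distrib sum_distrib_left[symmetric])
    then show "m * (\<Sum>v\<in>\<delta>. (f v + t * h v)\<^sup>2) \<le> energy (\<lambda>v. f v + t * h v) (\<lambda>v. f v + t * h v)"
      by (rule min)
  qed
  also have "(\<Sum>v\<in>\<delta>. f v * h v) = (\<Sum>v\<in>\<delta>. f v * of_bool (v = w)) - c * (\<Sum>v\<in>\<delta>. f v)"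
    by (simp add: h_def sum_subtractf sum_distrib_left algebra_simps)
  also have "\<dots> = bd f w"
    by (simp add: bd_def sum_times_of_bool_eq finite_boundary f(1))
  finally show ?thesis .
qed

text \<open>The minimum of the quotient over mean-zero functions is an eigenvalue. It is the
  smallest nonzero one, because eigenfunctions for nonzero eigenvalues have mean zero on the
  boundary.\<close>

lemma lambda2_rayleigh:
  obtains f where "lambda2 G > 0" "(\<Sum>w\<in>\<delta>. (f w)\<^sup>2) = 1"
    "\<And>w. w \<in> V \<Longrightarrow> L f w = lambda2 G * bd f w"
    "\<And>g. (\<Sum>w\<in>\<delta>. g w) = 0 \<Longrightarrow> lambda2 G * (\<Sum>w\<in>\<delta>. (g w)\<^sup>2) \<le> energy g g"
proof -
  obtain a where a: "a \<in> \<delta>" using boundary_nonempty by blast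
  obtain b where b: "b \<in> \<delta>" "b \<noteq> a" using boundary_minus_nonempty[of a] by blast
  let ?e = "\<lambda>w. of_bool (w = a) - of_bool (w = b) :: real"
  obtain f where f: "(\<Sum>w\<in>\<delta>. f w) = 0" "(\<Sum>w\<in>\<delta>. (f w)\<^sup>2) = 1"
    and min: "\<And>g. (\<Sum>w\<in>\<delta>. g w) = 0 \<Longrightarrow> energy f f * (\<Sum>w\<in>\<delta>. (g w)\<^sup>2) \<le> energy g g"
  proof (rule minimizer_exists[of \<delta> "{f. (\<Sum>w\<in>\<delta>. f w) = 0}" ?e a])
    show "closed {f :: 'a \<Rightarrow> real. (\<Sum>w\<in>\<delta>. f w) = 0}"
      by (intro closed_Collect_eq continuous_intros continuous_on_product_coordinates)
    show "?e \<in> {f. (\<Sum>w\<in>\<delta>. f w) = 0}"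
      using a b finite_boundary by (simp add: sum_subtractf of_bool_def)
    show "g \<in> {f. (\<Sum>w\<in>\<delta>. f w) = 0}"
      if "f \<in> {f. (\<Sum>w\<in>\<delta>. f w) = 0}" "\<And>w. w \<in> V \<Longrightarrow> f w = g w" for f g :: "'a \<Rightarrow> real"
    proof -
      have "(\<Sum>w\<in>\<delta>. g w) = (\<Sum>w\<in>\<delta>. f w)" using that(2) boundary_subset by (intro sum.cong) auto
      then show ?thesis using that(1) by simp
    qed
  qed (use a b boundary_subset in \<open>auto simp: sum_distrib_left[symmetric]\<close>)
  define m where "m = energy f f"
  have min: "m * (\<Sum>w\<in>\<delta>. (g w)\<^sup>2) \<le> energy g g" if "(\<Sum>w\<in>\<delta>. g w) = 0" for g
    using min[OF that] by (simp add: m_def)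
  have eig: "L f w = m * bd f w" if "w \<in> V" for w
    by (rule mean_zero_minimizer_eigen[OF f(1) _ min that]) (simp_all add: m_def f)
  obtain w1 where w1: "w1 \<in> \<delta>" "f w1 \<noteq> 0"
    using f(2) by (metis sum.neutral zero_neq_one zero_power2)
  have "m \<noteq> 0"
  proof
    assume "m = 0"
    then have "f w = f w1" if "w \<in> \<delta>" for w
      using that w1 boundary_subset by (intro energy_0_const) (auto simp: m_def)
    then have "(\<Sum>w\<in>\<delta>. f w) = (\<Sum>w\<in>\<delta>. f w1)" by (rule sum.cong[OF refl])
    then show False using f(1) w1 finite_boundary by auto
  qed
  then have pos: "m > 0" using energy_nonneg[of f] by (simp add: m_def)
  have "lambda2 G = m"
    unfolding lambda2_def
  proof (rule Min_eqI)
    show "finite {lam. steklov_eigenvalue G lam \<and> lam \<noteq> 0}"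
      using finite_eigenvalues by (rule rev_finite_subset) blast
    show "m \<in> {lam. steklov_eigenvalue G lam \<and> lam \<noteq> 0}"
      using eig w1 boundary_subset \<open>m \<noteq> 0\<close> by (auto simp: steklov_eigenvalue_iff)
    fix lam assume "lam \<in> {lam. steklov_eigenvalue G lam \<and> lam \<noteq> 0}"
    then obtain g w0 where g: "lam \<noteq> 0" "w0 \<in> V" "g w0 \<noteq> 0" "\<And>w. w \<in> V \<Longrightarrow> L g w = lam * bd g w"
      by (auto simp: steklov_eigenvalue_iff)
    have "energy g g = lam * (\<Sum>w\<in>\<delta>. g w * g w)"
      by (rule energy_eigen[of "{}"]) (use g in auto)
    then have "m * (\<Sum>w\<in>\<delta>. (g w)\<^sup>2) \<le> lam * (\<Sum>w\<in>\<delta>. (g w)\<^sup>2)"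
      using min[OF eigen_sum_boundary[OF g(4,1)]] by (simp add: power2_eq_square)
    then show "m \<le> lam" using eigen_sum_square_pos[OF g(4,2,3)] by simp
  qed
  then show thesis using that[of f] pos f(2) eig min by simp
qed

lemma lambda2_pos: "lambda2 G > 0"
  by (rule lambda2_rayleigh)

lemma lambda2_le: "(\<Sum>w\<in>\<delta>. g w) = 0 \<Longrightarrow> lambda2 G * (\<Sum>w\<in>\<delta>. (g w)\<^sup>2) \<le> energy g g"
  by (rule lambda2_rayleigh) blast

end

section \<open>Branches at a vertex\<close>

context ftree begin

lemma ftree_rooted_branch: "(y, x) \<in> E \<Longrightarrow> ftree (branch_with_root G y x)"
  by (rule ftree.intro) (rule finite_tree_rooted_branch)

lemma neighbors_rooted_branch:
  assumes yx: "(y, x) \<in> E" and w: "w \<in> Cmp y x"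
  shows "neighbors (branch_with_root G y x) w = N w"
  using Cmp_closed[OF w _ yx] w by (auto simp: neighbors_def arcs_ends_rooted_branch E_verts(1)[OF yx])

lemma neighbors_rooted_branch_root:
  assumes yx: "(y, x) \<in> E"
  shows "neighbors (branch_with_root G y x) x = {y}"
proof -
  have "v = y" if "(x, v) \<in> E" "v \<in> Cmp y x" for v
    using Cmp_closed[OF that(2) E_sym[OF that(1)] yx] root_notin_Cmp[OF yx] by auto
  moreover have "(x, x) \<notin> E" by (rule E_irrefl)
  ultimately show ?thesis
    using E_sym[OF yx] by (auto simp: neighbors_def arcs_ends_rooted_branch E_verts(1)[OF yx] self_in_Cmp)
qed

lemma boundary_rooted_branch:
  assumes yx: "(y, x) \<in> E"
  shows "boundary_verts (branch_with_root G y x) = insert x (\<delta> \<inter> Cmp y x)"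
proof -
  interpret B: ftree "branch_with_root G y x" using yx by (rule ftree_rooted_branch)
  have "w \<in> boundary_verts (branch_with_root G y x) \<longleftrightarrow> w = x \<or> w \<in> \<delta>" if "w = x \<or> w \<in> Cmp y x" for w
    using that neighbors_rooted_branch[OF yx, of w] neighbors_rooted_branch_root[OF yx] Cmp_subset[of y x] E_verts(1)[OF yx] root_notin_Cmp[OF yx]
    by (auto simp: B.boundary_iff boundary_iff verts_rooted_branch)
  then show ?thesis using B.boundary_subset by (auto simp: verts_rooted_branch E_verts(1)[OF yx])
qed

text \<open>Every arc belongs to exactly one rooted branch: two branches share only the vertex
  \<open>x\<close>, and there is no loop at \<open>x\<close>.\<close>

lemma energy_rooted_branch:
  assumes x: "x \<in> V"
  shows "energy f h = (\<Sum>y\<in>N x. ftree.energy (branch_with_root G y x) f h)"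
proof -
  define A where "A y = arcs_ends (branch_with_root G y x)" for y
  have yx: "(y, x) \<in> E" if "y \<in> N x" for y using that by (auto simp: N_iff intro: E_sym)
  have A: "A y = {(u, v) \<in> E. u \<in> insert x (Cmp y x) \<and> v \<in> insert x (Cmp y x)}" if "y \<in> N x" for y
    unfolding A_def by (rule arcs_ends_rooted_branch) (use that N_subset in auto)
  have "E = (\<Union>y\<in>N x. A y)"
  proof (intro equalityI subrelI)
    fix u v assume uv: "(u, v) \<in> E"
    show "(u, v) \<in> (\<Union>y\<in>N x. A y)"
    proof (cases "u = x")
      case True
      then have v: "v \<in> N x" using uv by (simp add: N_iff)
      then have "(u, v) \<in> A v" using uv True A[OF v] by (simp add: self_in_Cmp)
      then show ?thesis using v by blast
    next
      case False
      obtain y where y: "(x, y) \<in> E" "u \<in> Cmp y x"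
        using Cmp_towards[of u x] E_verts[OF uv] x False by auto
      then have "v = x \<or> v \<in> Cmp y x" using Cmp_closed[OF y(2) uv E_sym[OF y(1)]] by blast
      then show ?thesis using uv y A[of y] by (auto simp: N_iff)
    qed
  qed (use A in auto)
  then have "(\<Sum>(u, v)\<in>E. (f u - f v) * (h u - h v)) = (\<Sum>(u, v)\<in>(\<Union>y\<in>N x. A y). (f u - f v) * (h u - h v))"
    by simp
  also have "\<dots> = (\<Sum>y\<in>N x. \<Sum>(u, v)\<in>A y. (f u - f v) * (h u - h v))"
  proof (rule sum.UNION_disjoint)
    show "\<forall>y\<in>N x. finite (A y)"
      using A finite_E by (auto intro: finite_subset[rotated])
    have "A y \<inter> A z = {}" if "y \<in> N x" "z \<in> N x" "y \<noteq> z" for y z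
      using A[OF that(1)] A[OF that(2)] Cmp_disjoint[OF yx[OF that(1)] yx[OF that(2)] that(3)] E_irrefl
      by auto
    then show "\<forall>y\<in>N x. \<forall>z\<in>N x. y \<noteq> z \<longrightarrow> A y \<inter> A z = {}" by blast
  qed (rule finite_N)
  finally show ?thesis
    by (simp add: energy_def sum_divide_distrib ftree.energy_def[OF ftree_rooted_branch[OF yx]] A_def)
qed

text \<open>If \<open>x\<close> were a leaf, its own term would be missing on the right, hence the
  assumption that it is interior.\<close>

lemma sum_boundary_rooted_branch:
  assumes x: "x \<in> V" "x \<notin> \<delta>"
  shows "(\<Sum>w\<in>\<delta>. F w) = (\<Sum>y\<in>N x. \<Sum>w\<in>\<delta> \<inter> Cmp y x. F w)"
proof -
  have yx: "(y, x) \<in> E" if "y \<in> N x" for y using that by (auto simp: N_iff intro: E_sym)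
  have "\<exists>y\<in>N x. w \<in> Cmp y x" if w: "w \<in> \<delta>" for w
  proof -
    have "w \<in> V" "x \<noteq> w" using w x boundary_subset by auto
    then show ?thesis using Cmp_towards[of w x] x(1) by (auto simp: N_iff)
  qed
  then have "\<delta> = (\<Union>y\<in>N x. \<delta> \<inter> Cmp y x)" by auto
  then have "sum F \<delta> = sum F (\<Union>y\<in>N x. \<delta> \<inter> Cmp y x)" by simp
  also have "\<dots> = (\<Sum>y\<in>N x. \<Sum>w\<in>\<delta> \<inter> Cmp y x. F w)"
    using Cmp_disjoint[OF yx yx] finite_N finite_boundary by (intro sum.UNION_disjoint) auto
  finally show ?thesis .
qed

abbreviation branch_sigma :: "'a \<Rightarrow> 'a \<Rightarrow> real" where
  "branch_sigma x y \<equiv> sigma (branch_with_root G y x) x"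

text \<open>\<open>sigma_dirichlet\<close> inside the branch; the extra boundary vertex
  \<open>x\<close> contributes nothing to the sums because the functions vanish there.\<close>

lemma branch_sigma_dirichlet:
  assumes yx: "(y, x) \<in> E"
  obtains g where "branch_sigma x y > 0" "g x = 0" "\<And>w. w \<in> Cmp y x \<Longrightarrow> g w > 0"
    "ftree.energy (branch_with_root G y x) g g = branch_sigma x y * (\<Sum>w\<in>\<delta> \<inter> Cmp y x. (g w)\<^sup>2)"
    "\<And>f. f x = 0 \<Longrightarrow> branch_sigma x y * (\<Sum>w\<in>\<delta> \<inter> Cmp y x. (f w)\<^sup>2) \<le> ftree.energy (branch_with_root G y x) f f"
proof -
  interpret B: ftree "branch_with_root G y x" using yx by (rule ftree_rooted_branch)
  have x: "x \<in> B.\<delta>" by (simp add: boundary_rooted_branch yx)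
  have sum: "(\<Sum>w\<in>B.\<delta>. (f w)\<^sup>2) = (\<Sum>w\<in>\<delta> \<inter> Cmp y x. (f w)\<^sup>2)" if "f x = 0" for f :: "'a \<Rightarrow> real"
    unfolding boundary_rooted_branch[OF yx] using that root_notin_Cmp[OF yx] finite_boundary by simp
  obtain g where g: "branch_sigma x y > 0" "g x = 0" "\<And>w. w \<in> B.V - {x} \<Longrightarrow> g w > 0"
    "\<And>w. w \<in> B.V - {x} \<Longrightarrow> B.L g w = branch_sigma x y * B.bd g w"
    "\<And>f. f x = 0 \<Longrightarrow> branch_sigma x y * (\<Sum>w\<in>B.\<delta>. (f w)\<^sup>2) \<le> B.energy f f"
    using B.sigma_dirichlet[OF x] by blast
  have "B.energy g g = branch_sigma x y * (\<Sum>w\<in>B.\<delta>. g w * g w)"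
    by (rule B.energy_eigen[of "{x}"]) (use g in auto)
  then have e: "B.energy g g = branch_sigma x y * (\<Sum>w\<in>\<delta> \<inter> Cmp y x. (g w)\<^sup>2)"
    using sum[of g] g(2) by (simp add: power2_eq_square)
  show thesis
  proof (rule that[OF g(1,2) _ e])
    show "g w > 0" if "w \<in> Cmp y x" for w
      using g(3)[of w] that root_notin_Cmp[OF yx] E_verts(1)[OF yx] by (auto simp: verts_rooted_branch)
    show "branch_sigma x y * (\<Sum>w\<in>\<delta> \<inter> Cmp y x. (f w)\<^sup>2) \<le> B.energy f f" if "f x = 0" for f
      using g(5)[of f] sum[of f] that by simp
  qed
qed

lemma branch_minimizer:
  assumes yx: "(y, x) \<in> E"
  shows "\<exists>g. g x = 0 \<and> (\<forall>w\<in>Cmp y x. g w > 0) \<and>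
    ftree.energy (branch_with_root G y x) g g = branch_sigma x y * (\<Sum>w\<in>\<delta> \<inter> Cmp y x. (g w)\<^sup>2)"
  by (rule branch_sigma_dirichlet[OF yx]) (rule exI, intro conjI ballI)

lemma branch_sigma_pos: "(y, x) \<in> E \<Longrightarrow> branch_sigma x y > 0"
  by (rule branch_sigma_dirichlet)

lemma branch_sigma_le:
  assumes "(y, x) \<in> E" "f x = 0"
  shows "branch_sigma x y * (\<Sum>w\<in>\<delta> \<inter> Cmp y x. (f w)\<^sup>2) \<le> ftree.energy (branch_with_root G y x) f f"
proof (rule branch_sigma_dirichlet[OF assms(1)])
  assume "\<And>f. f x = 0 \<Longrightarrow> branch_sigma x y * (\<Sum>w\<in>\<delta> \<inter> Cmp y x. (f w)\<^sup>2)
    \<le> ftree.energy (branch_with_root G y x) f f"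
  from this[of f] assms(2) show ?thesis .
qed

text \<open>Restricted to the branch, \<open>f\<close> solves the same equations away from
  \<open>x\<close> and is a test function with quotient \<open>lam\<close>. The denominator is
  nonzero since \<open>f\<close> is not constant there.\<close>

lemma branch_sigma_le_eigenvalue:
  assumes yx: "(y, x) \<in> E" and "f x = 0" "f y \<noteq> 0"
    and eig: "\<And>w. w \<in> V \<Longrightarrow> L f w = lam * bd f w"
  shows "branch_sigma x y \<le> lam"
proof -
  interpret B: ftree "branch_with_root G y x" using yx by (rule ftree_rooted_branch)
  have V: "B.V = insert x (Cmp y x)" by (simp add: verts_rooted_branch E_verts(1)[OF yx])
  have "B.L f w = lam * B.bd f w" if "w \<in> B.V - {x}" for w
  proof -
    have w: "w \<in> Cmp y x" "w \<in> V" using that V Cmp_subset E_verts(1)[OF yx] by auto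
    have "B.bd f w = bd f w"
      using that w by (simp add: B.bd_def bd_def boundary_rooted_branch[OF yx])
    then show ?thesis
      using eig[OF w(2)] neighbors_rooted_branch[OF yx w(1)] by (simp add: laplacian_def)
  qed
  then have "B.energy f f = lam * (\<Sum>w\<in>B.\<delta>. f w * f w)"
    by (intro B.energy_eigen[of "{x}"]) (use \<open>f x = 0\<close> in auto)
  then have e: "B.energy f f = lam * (\<Sum>w\<in>\<delta> \<inter> Cmp y x. (f w)\<^sup>2)"
    using \<open>f x = 0\<close> root_notin_Cmp[OF yx] finite_boundary by (simp add: boundary_rooted_branch[OF yx] power2_eq_square)
  have "B.energy f f \<noteq> 0"
  proof
    assume "B.energy f f = 0"
    then have "f y = f x" by (rule B.energy_0_const) (auto simp: V self_in_Cmp)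
    then show False using assms(2,3) by simp
  qed
  then have "(\<Sum>w\<in>\<delta> \<inter> Cmp y x. (f w)\<^sup>2) \<noteq> 0" using e by auto
  then have "(\<Sum>w\<in>\<delta> \<inter> Cmp y x. (f w)\<^sup>2) > 0"
    by (metis antisym_conv2 sum_nonneg zero_le_power2)
  moreover have "branch_sigma x y * (\<Sum>w\<in>\<delta> \<inter> Cmp y x. (f w)\<^sup>2) \<le> B.energy f f"
    using yx \<open>f x = 0\<close> by (rule branch_sigma_le)
  ultimately show ?thesis using e by simp
qed

lemma two_neighbors_interior:
  assumes "y1 \<in> N x" "y2 \<in> N x" "y1 \<noteq> y2" shows "x \<notin> \<delta>"
proof
  assume "x \<in> \<delta>"
  then have "N x = {y1}" using assms(1) by (intro boundary_neighbors) (simp_all add: N_iff)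
  then show False using assms by simp
qed

text \<open>Test \<open>lambda2\<close> with the two branch minimizers, taken with opposite signs
  and zero elsewhere. \<open>T1\<close> and \<open>T2\<close> are their shares of the boundary
  square sum.\<close>

lemma lambda2_le_two_branches:
  assumes y1: "y1 \<in> N x" and y2: "y2 \<in> N x" and ne: "y1 \<noteq> y2"
  obtains T1 T2 where "T1 > 0" "T2 > 0"
    "lambda2 G * (T1 + T2) \<le> branch_sigma x y1 * T1 + branch_sigma x y2 * T2"
proof -
  have yx: "(y, x) \<in> E" if "y \<in> N x" for y using that by (auto simp: N_iff intro: E_sym)
  have x: "x \<in> V" "x \<notin> \<delta>" using E_verts yx[OF y1] two_neighbors_interior[OF y1 y2 ne] by auto
  have fin: "finite (\<delta> \<inter> X)" for X using finite_boundary by simp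
  define B where "B y = branch_with_root G y x" for y
  note B = ftree_rooted_branch[OF yx, folded B_def]
  define C where "C y = Cmp y x" for y
  have dis: "C y \<inter> C z = {}" if "y \<in> N x" "z \<in> N x" "y \<noteq> z" for y z
    unfolding C_def using Cmp_disjoint[OF yx yx] that by blast
  have xC: "x \<notin> C y" if "y \<in> N x" for y unfolding C_def by (rule root_notin_Cmp[OF yx[OF that]])
  have "\<exists>g. g x = 0 \<and> (\<forall>w\<in>C y1. g w > 0) \<and>
      ftree.energy (B y1) g g = branch_sigma x y1 * (\<Sum>w\<in>\<delta> \<inter> C y1. (g w)\<^sup>2)"
    unfolding B_def C_def by (rule branch_minimizer[OF yx[OF y1]])
  then obtain g1 where g1: "g1 x = 0" "\<And>w. w \<in> C y1 \<Longrightarrow> g1 w > 0"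
    "ftree.energy (B y1) g1 g1 = branch_sigma x y1 * (\<Sum>w\<in>\<delta> \<inter> C y1. (g1 w)\<^sup>2)"
    by blast
  have "\<exists>g. g x = 0 \<and> (\<forall>w\<in>C y2. g w > 0) \<and>
      ftree.energy (B y2) g g = branch_sigma x y2 * (\<Sum>w\<in>\<delta> \<inter> C y2. (g w)\<^sup>2)"
    unfolding B_def C_def by (rule branch_minimizer[OF yx[OF y2]])
  then obtain g2 where g2: "g2 x = 0" "\<And>w. w \<in> C y2 \<Longrightarrow> g2 w > 0"
    "ftree.energy (B y2) g2 g2 = branch_sigma x y2 * (\<Sum>w\<in>\<delta> \<inter> C y2. (g2 w)\<^sup>2)"
    by blast
  have leaf: "\<delta> \<inter> C y \<noteq> {}" if "y \<in> N x" for y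
    unfolding C_def using Cmp_leaf[OF yx[OF that]] by blast
  \<comment> \<open>the coefficients make the combination of the two branch minimizers sum to 0 on the boundary\<close>
  define a where "a = (\<Sum>w\<in>\<delta> \<inter> C y2. g2 w)"
  define b where "b = - (\<Sum>w\<in>\<delta> \<inter> C y1. g1 w)"
  have "a > 0" unfolding a_def using leaf[OF y2] fin g2(2) by (intro sum_pos) auto
  have "- b > 0" unfolding b_def using leaf[OF y1] fin g1(2) by (simp, intro sum_pos) auto
  define g where "g w = (if w \<in> C y1 then a * g1 w else if w \<in> C y2 then b * g2 w else 0)" for w
  have gx: "g x = 0" using xC y1 y2 by (simp add: g_def)
  have gC: "w \<in> C y1 \<Longrightarrow> g w = a * g1 w" "w \<in> C y2 \<Longrightarrow> g w = b * g2 w"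
    for w
    using dis[OF y1 y2 ne] by (auto simp: g_def)
  have gC0: "g w = 0" if "y \<in> N x" "y \<noteq> y1" "y \<noteq> y2" "w \<in> C y" for w y
    using dis[of y y1] dis[of y y2] that y1 y2 by (auto simp: g_def)
  have two: "(\<Sum>y\<in>N x. F y) = F y1 + F y2" if "\<And>y. y \<in> N x \<Longrightarrow> y \<noteq> y1 \<Longrightarrow> y \<noteq> y2 \<Longrightarrow> F y = 0"
    for F :: "'a \<Rightarrow> real"
  proof -
    have "(\<Sum>y\<in>N x. F y) = (\<Sum>y\<in>{y1, y2}. F y)"
      using that y1 y2 finite_N by (intro sum.mono_neutral_right) auto
    then show ?thesis using ne by simp
  qed
  have s0: "(\<Sum>w\<in>\<delta>. g w) = 0"
  proof -
    have "(\<Sum>w\<in>\<delta>. g w) = (\<Sum>w\<in>\<delta> \<inter> C y1. g w) + (\<Sum>w\<in>\<delta> \<inter> C y2. g w)"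
      unfolding sum_boundary_rooted_branch[OF x] C_def[symmetric] by (rule two) (simp add: gC0)
    also have "\<dots> = a * (\<Sum>w\<in>\<delta> \<inter> C y1. g1 w) + b * (\<Sum>w\<in>\<delta> \<inter> C y2. g2 w)"
      by (simp add: gC sum_distrib_left)
    also have "\<dots> = a * (- b) + b * a"
      by (simp add: a_def b_def)
    finally show ?thesis by simp
  qed
  have sq: "(\<Sum>w\<in>\<delta>. (g w)\<^sup>2)
      = a\<^sup>2 * (\<Sum>w\<in>\<delta> \<inter> C y1. (g1 w)\<^sup>2) + b\<^sup>2 * (\<Sum>w\<in>\<delta> \<inter> C y2. (g2 w)\<^sup>2)"
  proof -
    have "(\<Sum>w\<in>\<delta>. (g w)\<^sup>2) = (\<Sum>w\<in>\<delta> \<inter> C y1. (g w)\<^sup>2) + (\<Sum>w\<in>\<delta> \<inter> C y2. (g w)\<^sup>2)"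
      unfolding sum_boundary_rooted_branch[OF x] C_def[symmetric] by (rule two) (simp add: gC0)
    then show ?thesis by (simp add: gC power_mult_distrib sum_distrib_left)
  qed
  have VB: "verts (B y) = insert x (C y)" if "y \<in> N x" for y
    using E_verts(1)[OF yx[OF that]] by (simp add: B_def C_def verts_rooted_branch)
  have scaled: "ftree.energy (B y) g g = c\<^sup>2 * ftree.energy (B y) h h"
    if y: "y \<in> N x" and "h x = 0" "\<And>w. w \<in> C y \<Longrightarrow> g w = c * h w" for y c h
  proof -
    interpret B: ftree "B y" by (rule B[OF y])
    have "B.energy g g = B.energy (\<lambda>w. c * h w + 0 * h w) (\<lambda>w. c * h w + 0 * h w)"
      by (rule B.energy_cong) (use that gx VB[OF y] in auto)
    then show ?thesis unfolding B.energy_square_add by simp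
  qed
  have "energy g g = ftree.energy (B y1) g g + ftree.energy (B y2) g g"
    unfolding energy_rooted_branch[OF x(1)] B_def[symmetric]
  proof (rule two)
    fix y assume "y \<in> N x" "y \<noteq> y1" "y \<noteq> y2"
    then show "ftree.energy (B y) g g = 0"
      using scaled[of y "\<lambda>_. 0" 0] by (simp add: gC0)
  qed
  then have en: "energy g g = branch_sigma x y1 * (a\<^sup>2 * (\<Sum>w\<in>\<delta> \<inter> C y1. (g1 w)\<^sup>2))
      + branch_sigma x y2 * (b\<^sup>2 * (\<Sum>w\<in>\<delta> \<inter> C y2. (g2 w)\<^sup>2))"
    using scaled[OF y1 g1(1) gC(1)] scaled[OF y2 g2(1) gC(2)] g1(3) g2(3) by simp
  have "(\<Sum>w\<in>\<delta> \<inter> C y1. (g1 w)\<^sup>2) > 0" "(\<Sum>w\<in>\<delta> \<inter> C y2. (g2 w)\<^sup>2) > 0"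
    using leaf y1 y2 fin g1(2) g2(2) by (auto intro!: sum_pos zero_less_power)
  then show thesis
    using that[of "a\<^sup>2 * (\<Sum>w\<in>\<delta> \<inter> C y1. (g1 w)\<^sup>2)" "b\<^sup>2 * (\<Sum>w\<in>\<delta> \<inter> C y2. (g2 w)\<^sup>2)"]
      lambda2_le[OF s0] \<open>a > 0\<close> \<open>- b > 0\<close> sq en by auto
qed

text \<open>\<open>lambda2 G\<close> is at most an average of the two values with positive weights,
  so if neither exceeds it, neither can be smaller.\<close>

lemma branch_sigma_pair_eq:
  assumes "y1 \<in> N x" "y2 \<in> N x" "y1 \<noteq> y2"
    and "branch_sigma x y1 \<le> lambda2 G" "branch_sigma x y2 \<le> lambda2 G"
  shows "branch_sigma x y1 = lambda2 G"
proof (rule ccontr)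
  assume "branch_sigma x y1 \<noteq> lambda2 G"
  then have l: "branch_sigma x y1 < lambda2 G" using assms by simp
  obtain T1 T2 where T: "T1 > 0" "T2 > 0"
    "lambda2 G * (T1 + T2) \<le> branch_sigma x y1 * T1 + branch_sigma x y2 * T2"
    using lambda2_le_two_branches[OF assms(1-3)] .
  have "branch_sigma x y1 * T1 < lambda2 G * T1" using l T(1) by simp
  moreover have "branch_sigma x y2 * T2 \<le> lambda2 G * T2" using assms(5) T(2) by simp
  ultimately show False using T(3) by (simp add: algebra_simps)
qed

text \<open>The values at the neighbours of the zero \<open>x\<close> sum to 0, so a second
  neighbour is nonzero and both branches are pinned to \<open>lambda2 G\<close>. A branch with a
  smaller value would contradict \<open>branch_sigma_pair_eq\<close> when paired with one of
  them.\<close>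

lemma vanishing_eigenfunction_branches:
  assumes eig: "\<And>w. w \<in> V \<Longrightarrow> L f w = lambda2 G * bd f w"
    and x: "f x = 0" and y: "y \<in> N x" "f y \<noteq> 0"
  obtains y1 y2 where "y1 \<in> N x" "y2 \<in> N x" "y1 \<noteq> y2"
    "branch_sigma x y1 = lambda2 G" "branch_sigma x y2 = lambda2 G"
    "\<And>y. y \<in> N x \<Longrightarrow> lambda2 G \<le> branch_sigma x y"
proof -
  have yx: "(y, x) \<in> E" if "y \<in> N x" for y using that by (auto simp: N_iff intro: E_sym)
  have xV: "x \<in> V" using yx[OF y(1)] E_verts by blast
  \<comment> \<open>True even if \<open>x\<close> is a boundary vertex, because
    \<open>bd f x = 0\<close> in either case.\<close>
  have "L f x = 0" using eig[OF xV] x by (simp add: bd_def)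
  then have "(\<Sum>v\<in>N x. f v) = 0" using x by (simp add: laplacian_def sum_negf)
  then have "f y + (\<Sum>v\<in>N x - {y}. f v) = 0" using sum.remove[OF finite_N y(1), of f] by simp
  then have "(\<Sum>v\<in>N x - {y}. f v) \<noteq> 0" using y(2) by auto
  then obtain y2 where y2: "y2 \<in> N x" "y2 \<noteq> y" "f y2 \<noteq> 0"
    by (metis (mono_tags, lifting) DiffE insertI1 sum.neutral)
  have le: "branch_sigma x y \<le> lambda2 G" "branch_sigma x y2 \<le> lambda2 G"
    using branch_sigma_le_eigenvalue[OF yx x _ eig] y y2 by blast+
  have eq: "branch_sigma x y = lambda2 G" "branch_sigma x y2 = lambda2 G"
    using branch_sigma_pair_eq[of y x y2] branch_sigma_pair_eq[of y2 x y] y y2 le by auto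
  have "lambda2 G \<le> branch_sigma x z" if z: "z \<in> N x" for z
  proof (rule ccontr)
    assume "\<not> ?thesis"
    then have "branch_sigma x z < lambda2 G" by simp
    then show False
      using branch_sigma_pair_eq[of z x y] branch_sigma_pair_eq[of z x y2] z y y2 le eq by force
  qed
  then show thesis using that y(1) y2(1,2) eq by metis
qed

lemma lambda2_eq_branch_sigma:
  assumes y: "y1 \<in> N x" "y2 \<in> N x" "y1 \<noteq> y2"
    and eq: "branch_sigma x y1 = s" "branch_sigma x y2 = s"
    and min: "\<And>y. y \<in> N x \<Longrightarrow> s \<le> branch_sigma x y"
  shows "lambda2 G = s"
proof (rule antisym)
  obtain T1 T2 where T: "T1 > 0" "T2 > 0"
    "lambda2 G * (T1 + T2) \<le> branch_sigma x y1 * T1 + branch_sigma x y2 * T2"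
    using lambda2_le_two_branches[OF y] .
  then have "lambda2 G * (T1 + T2) \<le> s * (T1 + T2)" by (simp add: eq algebra_simps)
  then show "lambda2 G \<le> s" using T(1,2) by simp
next
  have yx: "(y, x) \<in> E" if "y \<in> N x" for y using that by (auto simp: N_iff intro: E_sym)
  have x: "x \<in> V" "x \<notin> \<delta>" using E_verts yx[OF y(1)] two_neighbors_interior[OF y] by auto
  have s: "s > 0" using branch_sigma_pos[OF yx[OF y(1)]] eq(1) by simp
  obtain f where f: "lambda2 G > 0" "(\<Sum>w\<in>\<delta>. (f w)\<^sup>2) = 1"
    "\<And>w. w \<in> V \<Longrightarrow> L f w = lambda2 G * bd f w"
    by (rule lambda2_rayleigh) blast
  have f0: "(\<Sum>w\<in>\<delta>. f w) = 0" using eigen_sum_boundary[OF f(3)] f(1) by simp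
  \<comment> \<open>The shift makes the branch inequalities applicable. It keeps the energy and, as
    \<open>f\<close> has mean zero on the boundary, does not decrease the square sum.\<close>
  define h where "h w = f w - f x" for w
  have "s * 1 \<le> s * (\<Sum>w\<in>\<delta>. (h w)\<^sup>2)"
    using s f(2) sum_shift_square[OF finite_boundary f0, of "f x"] by (simp add: h_def)
  also have "\<dots> = (\<Sum>y\<in>N x. s * (\<Sum>w\<in>\<delta> \<inter> Cmp y x. (h w)\<^sup>2))"
    by (simp add: sum_boundary_rooted_branch[OF x] sum_distrib_left)
  also have "\<dots> \<le> (\<Sum>y\<in>N x. ftree.energy (branch_with_root G y x) h h)"
  proof (rule sum_mono)
    fix y assume yN: "y \<in> N x"
    have "s * (\<Sum>w\<in>\<delta> \<inter> Cmp y x. (h w)\<^sup>2) \<le> branch_sigma x y * (\<Sum>w\<in>\<delta> \<inter> Cmp y x. (h w)\<^sup>2)"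
      by (intro mult_right_mono min yN sum_nonneg) simp
    also have "\<dots> \<le> ftree.energy (branch_with_root G y x) h h"
      by (rule branch_sigma_le[OF yx[OF yN]]) (simp add: h_def)
    finally show "s * (\<Sum>w\<in>\<delta> \<inter> Cmp y x. (h w)\<^sup>2) \<le> ftree.energy (branch_with_root G y x) h h" .
  qed
  also have "\<dots> = energy f f"
    using energy_rooted_branch[OF x(1), of h h] energy_shift[of f "f x" f "f x"] by (simp add: h_def[abs_def])
  also have "\<dots> = lambda2 G * (\<Sum>w\<in>\<delta>. f w * f w)"
    by (rule energy_eigen[of "{}"]) (use f in auto)
  finally show "s \<le> lambda2 G" using f(2) by (simp add: power2_eq_square)
qed

end

section \<open>Enumerations of the neighbours\<close>

lemma exists_enumeration_first_two:
  assumes "finite A" "a \<in> A" "b \<in> A" "a \<noteq> b"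
  shows "\<exists>xs. bij_betw xs {1..card A} A \<and> xs 1 = a \<and> xs (2::nat) = b"
proof -
  obtain l where l: "set l = A - {a, b}" "distinct l"
    using finite_distinct_list[of "A - {a, b}"] assms(1) by auto
  define L where "L = a # b # l"
  have L: "distinct L" "set L = A" using l assms by (auto simp: L_def)
  then have len: "length L = card A" using distinct_card by metis
  \<comment> \<open>Enumerations start at 1, list positions at 0.\<close>
  have "bij_betw (\<lambda>k. k - 1) {1..card A} {..<card A}"
    by (rule bij_betwI[where g=Suc]) auto
  moreover have "bij_betw ((!) L) {..<card A} A"
    using L len by (intro bij_betw_nth) auto
  ultimately have "bij_betw ((!) L \<circ> (\<lambda>k. k - 1)) {1..card A} A"
    by (rule bij_betw_trans)
  then show ?thesis by (intro exI[of _ "(!) L \<circ> (\<lambda>k. k - 1)"]) (simp add: L_def)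
qed

context ftree begin

lemma minimal_branches_enumeration:
  assumes y: "y1 \<in> N x" "y2 \<in> N x" "y1 \<noteq> y2"
    and eq: "branch_sigma x y1 = s" "branch_sigma x y2 = s"
    and min: "\<And>y. y \<in> N x \<Longrightarrow> s \<le> branch_sigma x y"
  obtains xs where "out_degree G x \<ge> 2" "bij_betw xs {1..out_degree G x} (N x)"
    "branch_sigma x (xs 1) = s" "branch_sigma x (xs 2) = s"
    "Min ((\<lambda>j. branch_sigma x (xs j)) ` {1..out_degree G x}) = s"
proof -
  obtain xs where xs: "bij_betw xs {1..card (N x)} (N x)" "xs 1 = y1" "xs 2 = y2"
    using exists_enumeration_first_two[OF finite_N y] by blast
  have "card {y1, y2} \<le> card (N x)" using y finite_N by (intro card_mono) auto
  then have deg: "card (N x) \<ge> 2" using y(3) by simp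
  have "Min ((\<lambda>j. branch_sigma x (xs j)) ` {1..card (N x)}) = s"
  proof (rule Min_eqI)
    show "s \<in> (\<lambda>j. branch_sigma x (xs j)) ` {1..card (N x)}"
      using eq(1) xs(2) deg by (intro image_eqI[of _ _ 1]) auto
    fix t assume "t \<in> (\<lambda>j. branch_sigma x (xs j)) ` {1..card (N x)}"
    then show "s \<le> t" using min bij_betwE[OF xs(1)] by auto
  qed simp
  then show thesis using that[of xs] xs eq deg by (simp add: out_degree_eq)
qed

lemma lambda2_eq_enumeration:
  assumes deg: "out_degree G x \<ge> 2" and xs: "bij_betw xs {1..out_degree G x} (N x)"
    and eq: "branch_sigma x (xs 1) = branch_sigma x (xs 2)"
    and min: "branch_sigma x (xs 2) = Min ((\<lambda>j. branch_sigma x (xs j)) ` {1..out_degree G x})"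
  shows "lambda2 G = branch_sigma x (xs 1)"
proof (rule lambda2_eq_branch_sigma)
  show "xs 1 \<in> N x" "xs 2 \<in> N x" using bij_betwE[OF xs] deg by auto
  have "inj_on xs {1..out_degree G x}" using xs by (rule bij_betw_imp_inj_on)
  then show "xs 1 \<noteq> xs 2" using deg by (auto dest: inj_onD)
  fix y assume "y \<in> N x"
  then have "y \<in> xs ` {1..out_degree G x}" using bij_betw_imp_surj_on[OF xs] by simp
  then obtain j where "j \<in> {1..out_degree G x}" "y = xs j" by blast
  then show "branch_sigma x (xs 1) \<le> branch_sigma x y"
    unfolding eq min by (auto intro: Min_le)
qed (use eq in simp_all)

end

section \<open>Embeddings of trees\<close>

locale ftree_embedding = T1: ftree G1 + T2: ftree G2
  for G1 :: "('a, 'b) pre_digraph" and G2 :: "('c, 'd) pre_digraph" +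
  fixes \<phi> :: "'a \<Rightarrow> 'c"
  assumes hom: "inj_graph_hom \<phi> G1 G2"
begin

lemma emb_verts: "v \<in> T1.V \<Longrightarrow> \<phi> v \<in> T2.V"
  and emb_inj: "u \<in> T1.V \<Longrightarrow> v \<in> T1.V \<Longrightarrow> \<phi> u = \<phi> v \<Longrightarrow> u = v"
  and emb_E: "(u, v) \<in> T1.E \<Longrightarrow> (\<phi> u, \<phi> v) \<in> T2.E"
  using hom by (auto simp: inj_graph_hom_def dest: inj_onD)

definition img :: "('c \<times> 'c) set" where
  "img = map_prod \<phi> \<phi> ` T1.E"

text \<open>The added arcs. Connectedness along \<open>R\<close> is an equivalence whose classes are
  the added pieces.\<close>

definition R :: "('c \<times> 'c) set" where
  "R = T2.E - img"

lemma img_E: "img \<subseteq> T2.E"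
  by (auto simp: img_def emb_E)

lemma img_sym: "(a, b) \<in> img \<Longrightarrow> (b, a) \<in> img"
  by (auto simp: img_def intro: T1.E_sym)

lemma R_sym: "(a, b) \<in> R \<Longrightarrow> (b, a) \<in> R"
  by (auto simp: R_def intro: T2.E_sym img_sym)

lemma emb_rtrancl: "(u, v) \<in> S\<^sup>* \<Longrightarrow> map_prod \<phi> \<phi> ` S \<subseteq> T \<Longrightarrow> (\<phi> u, \<phi> v) \<in> T\<^sup>*"
  by (induction rule: rtrancl_induct) (auto intro: rtrancl_into_rtrancl)

text \<open>Let \<open>u\<close> be the first step from \<open>v\<close> to \<open>v'\<close> in
  \<open>G1\<close>. The image of the way from \<open>u\<close> to \<open>v'\<close>, followed by
  the added path back to \<open>\<phi> v\<close>, would join the ends of an edge of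
  \<open>G2\<close> without using it.\<close>

lemma R_rtrancl_inj:
  assumes v: "v \<in> T1.V" "v' \<in> T1.V" and r: "(\<phi> v, \<phi> v') \<in> R\<^sup>*"
  shows "v = v'"
proof (rule ccontr)
  assume "v \<noteq> v'"
  then obtain u where u: "(v, u) \<in> T1.E" "v' \<in> T1.Cmp u v"
    using T1.Cmp_towards[OF v(2,1)] by blast
  let ?C = "T2.Cut (\<phi> u) (\<phi> v)"
  have uE: "(\<phi> u, \<phi> v) \<in> img" using T1.E_sym[OF u(1)] by (auto simp: img_def)
  have "map_prod \<phi> \<phi> ` T1.Cut u v \<subseteq> ?C"
    using emb_E T1.E_verts[OF u(1)]
    by (auto simp: T1.Cut_def T2.Cut_def dest!: emb_inj[rotated 2] dest: T1.E_verts)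
  then have "(\<phi> u, \<phi> v') \<in> ?C\<^sup>*"
    using u(2) emb_rtrancl by (auto simp: T1.Cmp_def)
  moreover have "R \<subseteq> ?C" using uE img_sym[OF uE] by (auto simp: R_def T2.Cut_def)
  then have "(\<phi> v', \<phi> v) \<in> ?C\<^sup>*"
    using r rtrancl_mono T2.Cut_rtrancl_sym by blast
  ultimately have "\<phi> v \<in> T2.Cmp (\<phi> u) (\<phi> v)" by (auto simp: T2.Cmp_def)
  then show False using T2.root_notin_Cmp uE img_E by blast
qed

lemma R_reach:
  assumes "w \<in> T2.V" shows "\<exists>v\<in>T1.V. (\<phi> v, w) \<in> R\<^sup>*"
proof -
  obtain v0 where v0: "v0 \<in> T1.V" using T1.card_verts by fastforce
  have "(\<phi> v0, w) \<in> T2.E\<^sup>*" using T2.E_rtrancl emb_verts v0 assms by blast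
  then show ?thesis
  proof induction
    case base then show ?case using v0 by blast
  next
    case (step a b)
    show ?case
    proof (cases "(a, b) \<in> img")
      case True
      then show ?thesis by (auto simp: img_def dest: T1.E_verts)
    next
      case False
      then have "(a, b) \<in> R" using step by (simp add: R_def)
      then show ?thesis using step(3) by (auto intro: rtrancl_into_rtrancl)
    qed
  qed
qed

text \<open>\<open>\<rho>\<close> contracts every component of \<open>G2\<close> minus the image of the arcs of \<open>G1\<close> to the only
  vertex of \<open>\<phi> ` V\<^sub>1\<close> it contains, so \<open>f \<circ> \<rho>\<close> has the same energy as \<open>f\<close>.\<close>

definition \<rho> :: "'c \<Rightarrow> 'a" where
  "\<rho> w = (SOME v. v \<in> T1.V \<and> (\<phi> v, w) \<in> R\<^sup>*)"

lemma rho: assumes "w \<in> T2.V" shows "\<rho> w \<in> T1.V" "(\<phi> (\<rho> w), w) \<in> R\<^sup>*"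
  using someI_ex[of "\<lambda>v. v \<in> T1.V \<and> (\<phi> v, w) \<in> R\<^sup>*"] R_reach[OF assms]
  by (auto simp: \<rho>_def)

lemma R_rtrancl_sym: "(a, b) \<in> R\<^sup>* \<Longrightarrow> (b, a) \<in> R\<^sup>*"
  by (rule symD[OF sym_rtrancl]) (auto intro: symI R_sym)

lemma R_rtrancl_verts: "(a, b) \<in> R\<^sup>* \<Longrightarrow> a \<in> T2.V \<Longrightarrow> b \<in> T2.V"
  by (induction rule: rtrancl_induct) (auto simp: R_def dest: T2.E_verts)

lemma rho_eqI: assumes v: "v \<in> T1.V" and "(\<phi> v, w) \<in> R\<^sup>*" shows "\<rho> w = v"
proof -
  have "w \<in> T2.V" using R_rtrancl_verts[OF assms(2) emb_verts[OF v]] .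
  note r = rho[OF this]
  have "(\<phi> (\<rho> w), \<phi> v) \<in> R\<^sup>*" using r(2) R_rtrancl_sym[OF assms(2)] by (rule rtrancl_trans)
  then show ?thesis using R_rtrancl_inj[OF r(1) v] by simp
qed

lemma rho_emb: "v \<in> T1.V \<Longrightarrow> \<rho> (\<phi> v) = v"
  by (rule rho_eqI) auto

lemma rho_R: assumes "(a, b) \<in> R" shows "\<rho> a = \<rho> b"
proof -
  have "a \<in> T2.V" using assms T2.E_verts by (auto simp: R_def)
  then have "\<rho> b = \<rho> a" by (intro rho_eqI rho rtrancl_into_rtrancl[OF _ assms])
  then show ?thesis by simp
qed

text \<open>Added arcs contribute nothing, as \<open>\<rho>\<close> is constant along them; the
  remaining arcs correspond to those of \<open>G1\<close>.\<close>

lemma energy_rho: "T2.energy (f \<circ> \<rho>) (f \<circ> \<rho>) = T1.energy f f"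
proof -
  let ?F = "\<lambda>(u, v). ((f \<circ> \<rho>) u - (f \<circ> \<rho>) v) * ((f \<circ> \<rho>) u - (f \<circ> \<rho>) v)"
  have "sum ?F T2.E = sum ?F img"
  proof (rule sum.mono_neutral_right[OF T2.finite_E img_E])
    have "f (\<rho> a) = f (\<rho> b)" if "(a, b) \<in> T2.E - img" for a b
      using rho_R[of a b] that by (simp add: R_def)
    then show "\<forall>p\<in>T2.E - img. ?F p = 0" by auto
  qed
  also have "\<dots> = sum (?F \<circ> map_prod \<phi> \<phi>) T1.E"
    unfolding img_def
  proof (rule sum.reindex)
    show "inj_on (map_prod \<phi> \<phi>) T1.E"
      unfolding inj_on_def by (auto intro: emb_inj dest: T1.E_verts)
  qed
  also have "\<dots> = (\<Sum>(u, v)\<in>T1.E. (f u - f v) * (f u - f v))"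
    by (rule sum.cong) (auto simp: rho_emb dest: T1.E_verts)
  finally show ?thesis by (simp add: T1.energy_def T2.energy_def)
qed

text \<open>The part of \<open>G2\<close> beyond the added arc contains no vertex of the image,
  because the image is connected without that arc. So \<open>\<rho>\<close> is constant there, and
  any leaf in it will do.\<close>

lemma hanging_leaf:
  assumes v: "v \<in> T1.V" and vu: "(\<phi> v, u) \<in> R"
  obtains w where "w \<in> T2.\<delta>" "\<rho> w = v" "\<And>w'. (w, w') \<in> T2.E \<Longrightarrow> \<rho> w' = v"
proof -
  have uv: "(u, \<phi> v) \<in> T2.E" using R_sym[OF vu] by (simp add: R_def)
  have out: "\<phi> v' \<notin> T2.Cmp u (\<phi> v)" if v': "v' \<in> T1.V" for v'
  proof
    assume "\<phi> v' \<in> T2.Cmp u (\<phi> v)"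
    then have "(u, \<phi> v') \<in> (T2.Cut u (\<phi> v))\<^sup>*" by (simp add: T2.Cmp_def)
    also have "(v', v) \<in> T1.E\<^sup>*" using T1.E_rtrancl v v' by blast
    then have "(\<phi> v', \<phi> v) \<in> (T2.Cut u (\<phi> v))\<^sup>*"
    proof (rule emb_rtrancl)
      show "map_prod \<phi> \<phi> ` T1.E \<subseteq> T2.Cut u (\<phi> v)"
        using img_E vu R_sym[OF vu] by (auto simp: img_def[symmetric] R_def T2.Cut_def)
    qed
    finally have "\<phi> v \<in> T2.Cmp u (\<phi> v)" by (simp add: T2.Cmp_def)
    then show False using T2.root_notin_Cmp[OF uv] by blast
  qed
  have rho_v: "\<rho> w = v" if "w \<in> T2.Cmp u (\<phi> v)" for w
  proof -
    have "(u, w) \<in> (T2.Cut u (\<phi> v))\<^sup>*" using that by (simp add: T2.Cmp_def)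
    then show ?thesis
    proof induction
      case base
      show ?case using rho_R[OF vu] rho_emb[OF v] by simp
    next
      case (step a b)
      have "a \<in> T2.Cmp u (\<phi> v)" using step(1) by (simp add: T2.Cmp_def)
      then have "(a, b) \<notin> img" using out by (auto simp: img_def dest: T1.E_verts)
      then have "(a, b) \<in> R" using step(2) by (simp add: R_def T2.Cut_def)
      then show ?case using rho_R step(3) by simp
    qed
  qed
  obtain w where w: "w \<in> T2.\<delta> \<inter> T2.Cmp u (\<phi> v)" using T2.Cmp_leaf[OF uv] by blast
  have "\<rho> w' = v" if "(w, w') \<in> T2.E" for w'
    using T2.Cmp_closed[OF _ that uv] w rho_v rho_emb[OF v] by blast
  then show thesis using that w rho_v by blast
qed

lemma boundary_lift:
  assumes "v \<in> T1.\<delta>" shows "\<exists>w\<in>T2.\<delta>. \<rho> w = v"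
proof (cases "\<phi> v \<in> T2.\<delta>")
  case True
  then show ?thesis using rho_emb assms T1.boundary_subset by blast
next
  case False
  have v: "v \<in> T1.V" using assms T1.boundary_subset by blast
  obtain v1 where v1: "(v, v1) \<in> T1.E" using T1.neighbor_exists[OF v] by blast
  obtain u where "u \<in> T2.N (\<phi> v) - {\<phi> v1}"
    using T2.notin_boundary_neighbors[OF emb_E[OF v1] False] by blast
  then have u: "(\<phi> v, u) \<in> T2.E" "u \<noteq> \<phi> v1" by (simp_all add: T2.N_iff)
  \<comment> \<open>\<open>v\<close> has the single neighbour \<open>v1\<close> in
    \<open>G1\<close>, so any further arc at \<open>\<phi> v\<close> is an added one.\<close>
  have "(\<phi> v, u) \<notin> img"
  proof
    assume "(\<phi> v, u) \<in> img"
    then obtain a b where ab: "(a, b) \<in> T1.E" "\<phi> a = \<phi> v" "\<phi> b = u" by (auto simp: img_def)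
    have "a = v" using emb_inj[OF T1.E_verts(1)[OF ab(1)] v ab(2)] .
    then have "b \<in> T1.N v" using ab(1) by (simp add: T1.N_iff)
    then have "b = v1" using T1.boundary_neighbors[OF assms v1] by simp
    then show False using ab u by simp
  qed
  then have "(\<phi> v, u) \<in> R" using u by (simp add: R_def)
  then show ?thesis using hanging_leaf[OF v] by metis
qed

lemma rho_test_function:
  defines "c f \<equiv> (\<Sum>w\<in>T2.\<delta>. f (\<rho> w)) / real (card T2.\<delta>)"
  shows "(\<Sum>w\<in>T2.\<delta>. f (\<rho> w) - c f) = 0"
    and "(\<Sum>v\<in>T1.\<delta>. (f v - c f)\<^sup>2) \<le> (\<Sum>w\<in>T2.\<delta>. (f (\<rho> w) - c f)\<^sup>2)"
    and "T2.energy (\<lambda>w. f (\<rho> w) - c f) (\<lambda>w. f (\<rho> w) - c f) = T1.energy f f"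
proof -
  show "(\<Sum>w\<in>T2.\<delta>. f (\<rho> w) - c f) = 0"
    using T2.boundary_nonempty T2.finite_boundary by (simp add: sum_subtractf c_def)
  \<comment> \<open>One boundary vertex of \<open>G2\<close> above each boundary vertex of
    \<open>G1\<close>; the choice is injective because \<open>\<rho>\<close> inverts it.\<close>
  obtain \<iota> where \<iota>: "\<And>v. v \<in> T1.\<delta> \<Longrightarrow> \<iota> v \<in> T2.\<delta>" "\<And>v. v \<in> T1.\<delta> \<Longrightarrow> \<rho> (\<iota> v) = v"
    using boundary_lift by metis
  have "inj_on \<iota> T1.\<delta>" by (metis \<iota>(2) inj_onI)
  then have "(\<Sum>w\<in>\<iota> ` T1.\<delta>. (f (\<rho> w) - c f)\<^sup>2) = (\<Sum>v\<in>T1.\<delta>. (f v - c f)\<^sup>2)"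
    by (simp add: sum.reindex \<iota>)
  moreover have "(\<Sum>w\<in>\<iota> ` T1.\<delta>. (f (\<rho> w) - c f)\<^sup>2) \<le> (\<Sum>w\<in>T2.\<delta>. (f (\<rho> w) - c f)\<^sup>2)"
    using \<iota>(1) T2.finite_boundary by (intro sum_mono2) auto
  ultimately show "(\<Sum>v\<in>T1.\<delta>. (f v - c f)\<^sup>2) \<le> (\<Sum>w\<in>T2.\<delta>. (f (\<rho> w) - c f)\<^sup>2)" by simp
  show "T2.energy (\<lambda>w. f (\<rho> w) - c f) (\<lambda>w. f (\<rho> w) - c f) = T1.energy f f"
    using energy_rho[of f] T2.energy_shift[of "\<lambda>w. f (\<rho> w)" "c f" "\<lambda>w. f (\<rho> w)" "c f"]
    by (simp add: comp_def)
qed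

text \<open>One computation yields both claims: \<open>lambda2 G2 * S\<close> is at most
  \<open>lambda2 G1\<close> and \<open>S\<close> is at least \<open>1 + n * c\<^sup>2\<close>.
  Equality forces \<open>S = 1\<close> and \<open>c = 0\<close>, so the uncentred lift is itself a
  mean-zero minimizer.\<close>

lemma lambda2_mono_and_lift:
  obtains f where "lambda2 G2 \<le> lambda2 G1"
    "(\<Sum>v\<in>T1.\<delta>. (f v)\<^sup>2) = 1" "\<And>v. v \<in> T1.V \<Longrightarrow> T1.L f v = lambda2 G1 * T1.bd f v"
    "\<And>w. lambda2 G2 = lambda2 G1 \<Longrightarrow> w \<in> T2.V \<Longrightarrow> T2.L (f \<circ> \<rho>) w = lambda2 G2 * T2.bd (f \<circ> \<rho>) w"
proof -
  obtain f where f: "lambda2 G1 > 0" "(\<Sum>v\<in>T1.\<delta>. (f v)\<^sup>2) = 1"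
    "\<And>v. v \<in> T1.V \<Longrightarrow> T1.L f v = lambda2 G1 * T1.bd f v"
    by (rule T1.lambda2_rayleigh) blast
  have f0: "(\<Sum>v\<in>T1.\<delta>. f v) = 0" using T1.eigen_sum_boundary[OF f(3)] f(1) by simp
  have "T1.energy f f = lambda2 G1 * (\<Sum>v\<in>T1.\<delta>. f v * f v)"
    by (rule T1.energy_eigen[of "{}"]) (use f in auto)
  then have ef: "T1.energy f f = lambda2 G1" using f(2) by (simp add: power2_eq_square)
  define c where "c = (\<Sum>w\<in>T2.\<delta>. f (\<rho> w)) / real (card T2.\<delta>)"
  define n where "n = real (card T1.\<delta>)"
  define S where "S = (\<Sum>w\<in>T2.\<delta>. (f (\<rho> w) - c)\<^sup>2)"
  note t = rho_test_function[of f, folded c_def]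
  have n: "n > 0" using T1.two_le_card_boundary by (simp add: n_def)
  have S: "1 + n * c\<^sup>2 \<le> S"
    using t(2) sum_shift_square[OF T1.finite_boundary f0, of c] f(2) by (simp add: S_def n_def)
  have le: "lambda2 G2 * S \<le> lambda2 G1"
    using T2.lambda2_le[OF t(1)] t(3) ef by (simp add: S_def)
  have pos: "lambda2 G2 > 0" by (rule T2.lambda2_pos)
  have "0 \<le> n * c\<^sup>2" using n by simp
  then have "1 \<le> S" using S by linarith
  then have "lambda2 G2 * 1 \<le> lambda2 G2 * S" using pos by (intro mult_left_mono) auto
  then have mono: "lambda2 G2 \<le> lambda2 G1" using le by simp
  have "T2.L (f \<circ> \<rho>) w = lambda2 G2 * T2.bd (f \<circ> \<rho>) w"
    if eq: "lambda2 G2 = lambda2 G1" and w: "w \<in> T2.V" for w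
  proof -
    have "S \<le> 1" using le eq pos by simp
    then have "n * c\<^sup>2 \<le> 0" and S1: "S = 1" using S \<open>1 \<le> S\<close> by auto
    then have "c = 0" using n by (simp add: mult_le_0_iff)
    then have F: "(\<Sum>w\<in>T2.\<delta>. (f \<circ> \<rho>) w) = 0" "(\<Sum>w\<in>T2.\<delta>. ((f \<circ> \<rho>) w)\<^sup>2) = 1"
      "T2.energy (f \<circ> \<rho>) (f \<circ> \<rho>) = lambda2 G1"
      using t(1,3) S1 ef by (simp_all add: S_def comp_def)
    show ?thesis
      by (rule T2.mean_zero_minimizer_eigen[OF F(1) _ T2.lambda2_le w]) (simp_all only: F eq mult_1_right)
  qed
  then show thesis using that mono f(2,3) by blast
qed

lemma lambda2_mono: "lambda2 G2 \<le> lambda2 G1"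
  by (rule lambda2_mono_and_lift)

section \<open>The equality case\<close>

lemma strict_extension_hanging_arc:
  assumes "R \<noteq> {}" shows "\<exists>v\<in>T1.V. \<exists>u. (\<phi> v, u) \<in> R"
proof -
  obtain a b where ab: "(a, b) \<in> R" using assms by auto
  then have a: "a \<in> T2.V" using T2.E_verts by (auto simp: R_def)
  have "(\<phi> (\<rho> a), b) \<in> R\<^sup>+" using rho(2)[OF a] ab by (rule rtrancl_into_trancl1)
  then obtain u where "(\<phi> (\<rho> a), u) \<in> R" by (meson tranclD)
  then show ?thesis using rho(1)[OF a] by blast
qed

text \<open>The lift is constant around a leaf of an added piece, so its Laplacian there is 0 and
  the eigenvalue equation forces \<open>f v = 0\<close>. On a path from \<open>v\<close> to a
  nonzero value there is an arc where \<open>f\<close> stops vanishing.\<close>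

lemma strict_extension_common_zero:
  assumes ne: "R \<noteq> {}" and eq: "lambda2 G2 = lambda2 G1"
  obtains f x y where "x \<in> T1.V" "f x = 0" "y \<in> T1.N x" "f y \<noteq> 0"
    "\<And>v. v \<in> T1.V \<Longrightarrow> T1.L f v = lambda2 G1 * T1.bd f v"
    "\<And>w. w \<in> T2.V \<Longrightarrow> T2.L (f \<circ> \<rho>) w = lambda2 G2 * T2.bd (f \<circ> \<rho>) w"
proof -
  obtain f where f: "(\<Sum>v\<in>T1.\<delta>. (f v)\<^sup>2) = 1"
    "\<And>v. v \<in> T1.V \<Longrightarrow> T1.L f v = lambda2 G1 * T1.bd f v"
    "\<And>w. w \<in> T2.V \<Longrightarrow> T2.L (f \<circ> \<rho>) w = lambda2 G2 * T2.bd (f \<circ> \<rho>) w"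
    by (rule lambda2_mono_and_lift) (use eq in blast)
  obtain v u where v: "v \<in> T1.V" "(\<phi> v, u) \<in> R" using strict_extension_hanging_arc[OF ne] by blast
  obtain w where w: "w \<in> T2.\<delta>" "\<rho> w = v" "\<And>w'. (w, w') \<in> T2.E \<Longrightarrow> \<rho> w' = v"
    using hanging_leaf[OF v] by blast
  have "T2.L (f \<circ> \<rho>) w = 0"
    using w(2,3) by (simp add: laplacian_def T2.N_iff)
  moreover have "T2.L (f \<circ> \<rho>) w = lambda2 G2 * f v"
    using f(3)[of w] w T2.boundary_subset by (auto simp: T2.bd_def)
  ultimately have fv: "f v = 0" using T2.lambda2_pos by simp
  obtain v' where v': "v' \<in> T1.\<delta>" "f v' \<noteq> 0"
    using f(1) by (metis sum.neutral zero_neq_one zero_power2)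
  have "(v, v') \<in> T1.E\<^sup>*" using T1.E_rtrancl v(1) v'(1) T1.boundary_subset by blast
  then have "f v' = 0 \<or> (\<exists>x y. (x, y) \<in> T1.E \<and> f x = 0 \<and> f y \<noteq> 0)"
    by (induction rule: rtrancl_induct) (use fv in auto)
  then obtain x y where xy: "(x, y) \<in> T1.E" "f x = 0" "f y \<noteq> 0" using v'(2) by blast
  then show thesis using that[of x f y] f(2,3) T1.E_verts by (auto simp: T1.N_iff)
qed

text \<open>With no added arcs every piece is a single vertex, so \<open>\<phi>\<close> is onto. An
  isomorphism also needs a map on arcs; it is injective and onto because neither graph has parallel
  arcs.\<close>

lemma digraph_iso_if_no_extension:
  assumes "R = {}" shows "digraph_iso G1 G2"
proof -
  have E: "T2.E = img" using assms img_E by (auto simp: R_def)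
  have V: "T2.V = \<phi> ` T1.V"
  proof
    show "T2.V \<subseteq> \<phi> ` T1.V" using R_reach assms by fastforce
  qed (auto simp: emb_verts)
  have "\<exists>b\<in>arcs G2. tail G2 b = \<phi> (tail G1 a) \<and> head G2 b = \<phi> (head G1 a)" if "a \<in> arcs G1" for a
    using emb_E[of "tail G1 a" "head G1 a"] that by (auto simp: arcs_ends_conv)
  then obtain \<alpha> where \<alpha>: "\<And>a. a \<in> arcs G1 \<Longrightarrow> \<alpha> a \<in> arcs G2"
    "\<And>a. a \<in> arcs G1 \<Longrightarrow> tail G2 (\<alpha> a) = \<phi> (tail G1 a)"
    "\<And>a. a \<in> arcs G1 \<Longrightarrow> head G2 (\<alpha> a) = \<phi> (head G1 a)"
    by metis
  define h where "h = \<lparr>iso_verts = \<phi>, iso_arcs = \<alpha>, iso_head = head G2, iso_tail = tail G2\<rparr>"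
  have inj: "inj_on \<alpha> (arcs G1)"
  proof (rule inj_onI)
    fix a b assume ab: "a \<in> arcs G1" "b \<in> arcs G1" "\<alpha> a = \<alpha> b"
    then have "tail G1 a = tail G1 b" "head G1 a = head G1 b"
      using \<alpha>(2)[OF ab(1)] \<alpha>(2)[OF ab(2)] \<alpha>(3)[OF ab(1)] \<alpha>(3)[OF ab(2)] by (auto intro!: emb_inj)
    then show "a = b" using ab T1.no_multi_arcs by (simp add: arc_to_ends_def)
  qed
  have "b \<in> \<alpha> ` arcs G1" if b: "b \<in> arcs G2" for b
  proof -
    have "(tail G2 b, head G2 b) \<in> img" using b E by (auto simp: arcs_ends_conv)
    then obtain a where a: "a \<in> arcs G1" "tail G2 b = \<phi> (tail G1 a)" "head G2 b = \<phi> (head G1 a)"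
      by (auto simp: img_def arcs_ends_conv)
    then have "b = \<alpha> a" using \<alpha>[OF a(1)] b T2.no_multi_arcs by (simp add: arc_to_ends_def)
    then show ?thesis using a(1) by blast
  qed
  then have A: "arcs G2 = \<alpha> ` arcs G1" using \<alpha>(1) by blast
  have "T1.digraph_isomorphism h"
    unfolding T1.digraph_isomorphism_def using inj \<alpha>(2,3) emb_inj T1.wf_digraph
    by (auto simp: h_def inj_on_def)
  moreover have "G2 = app_iso h G1" using V A by (simp add: app_iso_def h_def)
  ultimately show ?thesis by (auto simp: digraph_iso_def)
qed

end

lemma inj_graph_hom_app_iso:
  assumes "pre_digraph.digraph_isomorphism G h"
  shows "inj_graph_hom (iso_verts h) G (app_iso h G)"
  using assms by (force simp: pre_digraph.digraph_isomorphism_def inj_graph_hom_def arcs_ends_conv)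

text \<open>An isomorphism and its inverse are embeddings, so monotonicity applies in both
  directions.\<close>

lemma lambda2_digraph_iso:
  assumes "finite_tree G" "finite_tree H" "digraph_iso G H"
  shows "lambda2 G = lambda2 H"
proof -
  interpret G: ftree G by (rule ftree.intro) fact
  obtain h where h: "G.digraph_isomorphism h" "H = app_iso h G"
    using assms(3) by (auto simp: digraph_iso_def)
  have 1: "ftree_embedding G H (iso_verts h)"
    using assms h inj_graph_hom_app_iso by (simp add: ftree_embedding_def ftree_embedding_axioms_def ftree_def)
  have "inj_graph_hom (iso_verts (G.inv_iso h)) H (app_iso (G.inv_iso h) H)"
    unfolding h(2) by (rule inj_graph_hom_app_iso[OF G.digraph_isomorphism_invI[OF h(1)]])
  then have 2: "ftree_embedding H G (iso_verts (G.inv_iso h))"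
    using assms h by (simp add: ftree_embedding_def ftree_embedding_axioms_def ftree_def)
  show ?thesis
    using ftree_embedding.lambda2_mono[OF 1] ftree_embedding.lambda2_mono[OF 2] by simp
qed

theorem theorem1p3:
  fixes G1 :: "('a, 'b) pre_digraph"
    and G2 :: "('c, 'd) pre_digraph"
    and \<phi> :: "'a \<Rightarrow> 'c"
  assumes "finite_tree G1"
    and "finite_tree G2"
    and "inj_graph_hom \<phi> G1 G2"
  shows "lambda2 G2 \<le> lambda2 G1 \<and>
    (lambda2 G2 = lambda2 G1 \<longleftrightarrow>
       digraph_iso G1 G2 \<or>
       (\<exists>x\<in>verts G1. \<exists>(xs :: nat \<Rightarrow> 'a) (ys :: nat \<Rightarrow> 'c).
          let m1 = out_degree G1 x;
              m2 = out_degree G2 (\<phi> x);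
              s1 = (\<lambda>j. sigma (branch_with_root G1 (xs j) x) x);
              s2 = (\<lambda>s. sigma (branch_with_root G2 (ys s) (\<phi> x)) (\<phi> x))
          in m1 \<ge> 2 \<and> m2 \<ge> 2 \<and>
             bij_betw xs {1..m1} (neighbors G1 x) \<and>
             bij_betw ys {1..m2} (neighbors G2 (\<phi> x)) \<and>
             s1 1 = s1 2 \<and>
             s1 2 = Min (s1 ` {1..m1}) \<and>
             Min (s1 ` {1..m1}) = s2 1 \<and>
             s2 1 = s2 2 \<and>
             s2 2 = Min (s2 ` {1..m2})))"
    (is "_ \<and> (_ \<longleftrightarrow> _ \<or> ?cond)")
proof -
  interpret ftree_embedding G1 G2 \<phi>
    using assms by (simp add: ftree_embedding_def ftree_embedding_axioms_def ftree_def)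
  show ?thesis
  proof (intro conjI iffI lambda2_mono)
    assume eq: "lambda2 G2 = lambda2 G1"
    show "digraph_iso G1 G2 \<or> ?cond"
    proof (cases "R = {}")
      case True
      then show ?thesis using digraph_iso_if_no_extension by blast
    next
      case False
      obtain f x y where x: "x \<in> T1.V" "f x = 0" "y \<in> T1.N x" "f y \<noteq> 0"
        and eig1: "\<And>v. v \<in> T1.V \<Longrightarrow> T1.L f v = lambda2 G1 * T1.bd f v"
        and eig2: "\<And>w. w \<in> T2.V \<Longrightarrow> T2.L (f \<circ> \<rho>) w = lambda2 G2 * T2.bd (f \<circ> \<rho>) w"
        by (rule strict_extension_common_zero[OF False eq]) (rule that)
      have yV: "y \<in> T1.V" using x(3) T1.N_subset by blast
      obtain a b where "a \<in> T1.N x" "b \<in> T1.N x" "a \<noteq> b"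
        "T1.branch_sigma x a = lambda2 G1" "T1.branch_sigma x b = lambda2 G1"
        "\<And>y. y \<in> T1.N x \<Longrightarrow> lambda2 G1 \<le> T1.branch_sigma x y"
        by (rule T1.vanishing_eigenfunction_branches[OF eig1 x(2-4)]) (assumption, rule that)
      then obtain xs where xs: "out_degree G1 x \<ge> 2" "bij_betw xs {1..out_degree G1 x} (T1.N x)"
        "T1.branch_sigma x (xs 1) = lambda2 G1" "T1.branch_sigma x (xs 2) = lambda2 G1"
        "Min ((\<lambda>j. T1.branch_sigma x (xs j)) ` {1..out_degree G1 x}) = lambda2 G1"
        by (rule T1.minimal_branches_enumeration)
      \<comment> \<open>\<open>\<rho>\<close> inverts \<open>\<phi>\<close>, so the same vertex
        \<open>x\<close> is a zero with a nonzero neighbour in both trees.\<close>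
      have "(f \<circ> \<rho>) (\<phi> x) = 0" "\<phi> y \<in> T2.N (\<phi> x)" "(f \<circ> \<rho>) (\<phi> y) \<noteq> 0"
        using x yV emb_E by (auto simp: rho_emb T1.N_iff T2.N_iff)
      note x2 = this
      obtain a b where "a \<in> T2.N (\<phi> x)" "b \<in> T2.N (\<phi> x)" "a \<noteq> b"
        "T2.branch_sigma (\<phi> x) a = lambda2 G2" "T2.branch_sigma (\<phi> x) b = lambda2 G2"
        "\<And>y. y \<in> T2.N (\<phi> x) \<Longrightarrow> lambda2 G2 \<le> T2.branch_sigma (\<phi> x) y"
        by (rule T2.vanishing_eigenfunction_branches[OF eig2 x2]) (assumption, rule that)
      then obtain ys where ys: "out_degree G2 (\<phi> x) \<ge> 2"
        "bij_betw ys {1..out_degree G2 (\<phi> x)} (T2.N (\<phi> x))"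
        "T2.branch_sigma (\<phi> x) (ys 1) = lambda2 G2" "T2.branch_sigma (\<phi> x) (ys 2) = lambda2 G2"
        "Min ((\<lambda>j. T2.branch_sigma (\<phi> x) (ys j)) ` {1..out_degree G2 (\<phi> x)}) = lambda2 G2"
        by (rule T2.minimal_branches_enumeration)
      show ?thesis
        unfolding Let_def
        by (intro disjI2 bexI[OF _ x(1)] exI[of _ xs] exI[of _ ys] conjI)
          (simp_all add: xs ys eq del: One_nat_def)
    qed
  next
    assume "digraph_iso G1 G2 \<or> ?cond"
    then show "lambda2 G2 = lambda2 G1"
    proof
      assume "digraph_iso G1 G2"
      then show ?thesis using lambda2_digraph_iso[OF assms(1,2)] by simp
    next
      assume ?cond
      then show ?thesis
        unfolding Let_def
      proof (elim bexE exE conjE)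
        fix x xs ys
        assume 1: "out_degree G1 x \<ge> 2" "bij_betw xs {1..out_degree G1 x} (T1.N x)"
            "T1.branch_sigma x (xs 1) = T1.branch_sigma x (xs 2)"
            "T1.branch_sigma x (xs 2) = Min ((\<lambda>j. T1.branch_sigma x (xs j)) ` {1..out_degree G1 x})"
          and 2: "out_degree G2 (\<phi> x) \<ge> 2" "bij_betw ys {1..out_degree G2 (\<phi> x)} (T2.N (\<phi> x))"
            "T2.branch_sigma (\<phi> x) (ys 1) = T2.branch_sigma (\<phi> x) (ys 2)"
            "T2.branch_sigma (\<phi> x) (ys 2)
              = Min ((\<lambda>j. T2.branch_sigma (\<phi> x) (ys j)) ` {1..out_degree G2 (\<phi> x)})"
          and 3: "Min ((\<lambda>j. T1.branch_sigma x (xs j)) ` {1..out_degree G1 x})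
              = T2.branch_sigma (\<phi> x) (ys 1)"
        show "lambda2 G2 = lambda2 G1"
          using T1.lambda2_eq_enumeration[OF 1] T2.lambda2_eq_enumeration[OF 2] 1(3,4) 3 by metis
      qed
    qed
  qed
qed

end
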